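(* Let $A$ be a standard Borel space. If $\boldsymbol{\mu}$ is an exchangeable random measure on $A^{\mathbb{N}}$ (with respect to the coordinate-permuting action of $S_{\mathbb{N}}$), then there is an exchangeable sequence of random variables $(\boldsymbol{\lambda}_i)_{i\in\mathbb{N}}$ taking values in $B([0,1),\mathrm{Pr}\,A)$ such that \[\boldsymbol{\mu}(\cdot)\ \stackrel{\mathrm{law}}{=}\ \int_0^1\Big(\bigotimes_{i\in\mathbb{N}}\boldsymbol{\lambda}_i(t,\cdot)\Big)\,\mathrm{d}t.\]
   Context: $\mathrm{Pr}\,E$ is the space of Borel probability measures on a standard Borel space $E$, with the Borel structure generated by evaluations on Borel sets. $S_{\mathbb{N}}$ is the group of permutations of $\mathbb{N}$ fixing all but finitely many elements; it acts on $A^{\mathbb{N}}$ by $T^\sigma((x_n)_n)=(x_{\sigma(n)})_n$. An exchangeable random measure on $A^{\mathbb{N}}$ is a random variable $\boldsymbol{\mu}$ taking values in $\mathrm{Pr}(A^{\mathbb{N}})$ such that $\boldsymbol{\mu}$ and the image measure $T^\sigma_\ast\boldsymbol{\mu}$ have the same law (as $\mathrm{Pr}(A^{\mathbb{N}})$-valued random variables) for every $\sigma\in S_{\mathbb{N}}$. $B([0,1),\mathrm{Pr}\,A)$ is the space of Lebesgue-a.e. equivalence classes of measurable functions $f:[0,1)\to\mathrm{Pr}\,A$, $t\mapsto f(t,\cdot)$, with the (standard Borel) measurable structure generated by the functionals $f\mapsto\int_0^1\phi(t)f(t,C)\,\mathrm{d}t$ for all $\phi\in L^\infty[0,1)$ and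 Borel subsets $C\subseteq A$. A sequence of random variables $(\boldsymbol{\lambda}_i)_{i\in\mathbb{N}}$ is exchangeable if $(\boldsymbol{\lambda}_{\sigma(i)})_i$ has the same law as $(\boldsymbol{\lambda}_i)_i$ for every $\sigma\in S_{\mathbb{N}}$. The equality in law in the claim is between random variables valued in $\mathrm{Pr}(A^{\mathbb{N}})$. *)

theory Defs
  imports "HOL-Probability.Probability" "HOL-Combinatorics.Permutations"
begin

text \<open>
  Measurable spaces are represented by values of type \<^typ>\<open>'a measure\<close>, of which only
  the carrier and the sigma-algebra are used.
\<close>

definition standard_borel :: "'a measure \<Rightarrow> bool" where
  "standard_borel A \<longleftrightarrow>
     (\<exists>X. completely_metrizable_space X \<and> second_countable X \<and>
          space A = topspace X \<and> sets A = sigma_sets (topspace X) {U. openin X U})"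

definition finitary_perms :: "(nat \<Rightarrow> nat) set" where
  "finitary_perms = {\<sigma>. bij \<sigma> \<and> finite {n. \<sigma> n \<noteq> n}}"

lemma finitary_perms_eq_permutation: "finitary_perms = {\<sigma>. permutation \<sigma>}"
  by (simp add: finitary_perms_def permutation)

definition coord_perm :: "(nat \<Rightarrow> nat) \<Rightarrow> (nat \<Rightarrow> 'a) \<Rightarrow> (nat \<Rightarrow> 'a)" where
  "coord_perm \<sigma> x = (\<lambda>n. x (\<sigma> n))"

abbreviation seq_space :: "'a measure \<Rightarrow> (nat \<Rightarrow> 'a) measure" where
  "seq_space A \<equiv> PiM UNIV (\<lambda>_. A)"

definition same_law :: "'v measure \<Rightarrow> ('v \<Rightarrow> 'e) \<Rightarrow> 'w measure \<Rightarrow> ('w \<Rightarrow> 'e) \<Rightarrow> 'e measure \<Rightarrow> bool" where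
  "same_law V X W Y E \<longleftrightarrow>
     X \<in> V \<rightarrow>\<^sub>M E \<and> Y \<in> W \<rightarrow>\<^sub>M E \<and> distr V E X = distr W E Y"

definition exchangeable_random_measure ::
    "'w measure \<Rightarrow> 'a measure \<Rightarrow> ('w \<Rightarrow> (nat \<Rightarrow> 'a) measure) \<Rightarrow> bool" where
  "exchangeable_random_measure \<Omega> A \<mu> \<longleftrightarrow>
     \<mu> \<in> \<Omega> \<rightarrow>\<^sub>M prob_algebra (seq_space A) \<and>
     (\<forall>\<sigma>\<in>finitary_perms.
        same_law \<Omega> \<mu> \<Omega> (\<lambda>\<omega>. distr (\<mu> \<omega>) (seq_space A) (coord_perm \<sigma>))
          (prob_algebra (seq_space A)))"

definition exchangeable_sequence ::
    "'w measure \<Rightarrow> 'e measure \<Rightarrow> (nat \<Rightarrow> 'w \<Rightarrow> 'e) \<Rightarrow> bool" where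
  "exchangeable_sequence \<Omega> E X \<longleftrightarrow>
     (\<forall>i. X i \<in> \<Omega> \<rightarrow>\<^sub>M E) \<and>
     (\<forall>\<sigma>\<in>finitary_perms.
        same_law \<Omega> (\<lambda>\<omega> i. X (\<sigma> i) \<omega>) \<Omega> (\<lambda>\<omega> i. X i \<omega>) (seq_space E))"

definition unit_leb :: "real measure" where
  "unit_leb = restrict_space lborel {0..<1}"

text \<open>
  The space of measurable functions from [0,1) to \<^term>\<open>prob_algebra A\<close> modulo a.e. equality;
  its elements are actual equivalence classes. Values of the
  functions outside the unit interval are unconstrained, hence identified.
\<close>

definition ae_rel :: "'a measure \<Rightarrow> ((real \<Rightarrow> 'a measure) \<times> (real \<Rightarrow> 'a measure)) set" where
  "ae_rel A = {(f, g). f \<in> unit_leb \<rightarrow>\<^sub>M prob_algebra A \<and> g \<in> unit_leb \<rightarrow>\<^sub>M prob_algebra A \<and>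
                       (AE t in unit_leb. f t = g t)}"

definition ae_classes :: "'a measure \<Rightarrow> (real \<Rightarrow> 'a measure) set set" where
  "ae_classes A = (unit_leb \<rightarrow>\<^sub>M prob_algebra A) // ae_rel A"

definition representative :: "(real \<Rightarrow> 'a measure) set \<Rightarrow> real \<Rightarrow> 'a measure" where
  "representative c = (SOME f. f \<in> c)"

definition Linfty_unit :: "(real \<Rightarrow> real) set" where
  "Linfty_unit = {\<phi>. \<phi> \<in> borel_measurable unit_leb \<and> (\<exists>K. AE t in unit_leb. \<bar>\<phi> t\<bar> \<le> K)}"

definition pairing :: "(real \<Rightarrow> real) \<Rightarrow> 'a set \<Rightarrow> (real \<Rightarrow> 'a measure) set \<Rightarrow> real" where
  "pairing \<phi> C c = (\<integral>t. \<phi> t * measure (representative c t) C \<partial>unit_leb)"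

definition B_space :: "'a measure \<Rightarrow> (real \<Rightarrow> 'a measure) set measure" where
  "B_space A = sigma (ae_classes A)
     {pairing \<phi> C -` U \<inter> ae_classes A | \<phi> C U.
        \<phi> \<in> Linfty_unit \<and> C \<in> sets A \<and> U \<in> sets borel}"

definition product_mixture :: "(nat \<Rightarrow> (real \<Rightarrow> 'a measure) set) \<Rightarrow> (nat \<Rightarrow> 'a) measure" where
  "product_mixture l = Giry_Monad.bind unit_leb (\<lambda>t. PiM UNIV (\<lambda>i. representative (l i) t))"

subsection \<open>Independence of the choice of representatives\<close>

lemma prob_space_unit_leb: "prob_space unit_leb"
  by (auto simp: unit_leb_def emeasure_restrict_space intro!: prob_spaceI)

lemma equiv_ae_rel: "equiv (unit_leb \<rightarrow>\<^sub>M prob_algebra A) (ae_rel A)"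
proof (rule equivI)
  show "trans (ae_rel A)"
  proof (rule transI)
    fix f g h assume *: "(f, g) \<in> ae_rel A" "(g, h) \<in> ae_rel A"
    then have "AE t in unit_leb. f t = g t" "AE t in unit_leb. g t = h t"
      by (auto simp: ae_rel_def)
    then have "AE t in unit_leb. f t = h t" by eventually_elim simp
    with * show "(f, h) \<in> ae_rel A" by (auto simp: ae_rel_def)
  qed
qed (auto simp: ae_rel_def refl_on_def intro!: symI elim: eventually_mono)

lemma representative_in: "c \<in> ae_classes A \<Longrightarrow> representative c \<in> c"
  unfolding ae_classes_def representative_def
  using in_quotient_imp_non_empty[OF equiv_ae_rel] by (metis someI_ex ex_in_conv)

lemma representative_measurable:
  "c \<in> ae_classes A \<Longrightarrow> representative c \<in> unit_leb \<rightarrow>\<^sub>M prob_algebra A"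
  using representative_in in_quotient_imp_subset[OF equiv_ae_rel] by (fastforce simp: ae_classes_def)

lemma representative_AE:
  assumes "c \<in> ae_classes A" "f \<in> c"
  shows "AE t in unit_leb. representative c t = f t"
  using in_quotient_imp_in_rel[OF equiv_ae_rel, of c A "representative c" f]
    representative_in[OF assms(1)] assms by (auto simp: ae_classes_def ae_rel_def)

lemma pairing_eq:
  assumes c: "c \<in> ae_classes A" and f: "f \<in> c" and C: "C \<in> sets A" and \<phi>: "\<phi> \<in> Linfty_unit"
  shows "pairing \<phi> C c = (\<integral>t. \<phi> t * measure (f t) C \<partial>unit_leb)"
proof -
  have fm: "f \<in> unit_leb \<rightarrow>\<^sub>M prob_algebra A"
    using in_quotient_imp_subset[OF equiv_ae_rel] c f by (fastforce simp: ae_classes_def)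
  have m: "(\<lambda>t. measure (g t) C) \<in> borel_measurable unit_leb"
    if "g \<in> unit_leb \<rightarrow>\<^sub>M prob_algebra A" for g
    using measurable_compose[OF measurable_prob_algebraD[OF that] measurable_measure_subprob_algebra[OF C]] .
  have p: "\<phi> \<in> borel_measurable unit_leb" using \<phi> by (simp add: Linfty_unit_def)
  show ?thesis unfolding pairing_def
    by (rule integral_cong_AE)
      (use representative_AE[OF c f] p m[OF fm] m[OF representative_measurable[OF c]] in
        \<open>auto elim: eventually_mono\<close>)
qed

lemma measurable_PiM_kernel:
  assumes f: "\<And>i::nat. f i \<in> M \<rightarrow>\<^sub>M prob_algebra A"
  shows "(\<lambda>t. PiM UNIV (\<lambda>i. f i t)) \<in> M \<rightarrow>\<^sub>M prob_algebra (seq_space A)"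
proof (rule measurable_prob_algebra_generated[OF sets_PiM Int_stable_prod_algebra])
  show "prod_algebra UNIV (\<lambda>_. A) \<subseteq> Pow (\<Pi>\<^sub>E i\<in>UNIV. space A)"
    by (rule prod_algebra_sets_into_space)
next
  fix t assume t: "t \<in> space M"
  then have *: "prob_space (f i t)" "sets (f i t) = sets A" for i
    using measurable_space[OF f] by (auto simp: space_prob_algebra)
  show "prob_space (PiM UNIV (\<lambda>i. f i t))" by (intro prob_space_PiM *)
  show "sets (PiM UNIV (\<lambda>i. f i t)) = sets (seq_space A)" by (intro sets_PiM_cong * refl)
next
  fix D assume "D \<in> prod_algebra UNIV (\<lambda>_::nat. A)"
  then obtain J E where J: "finite J" "D = prod_emb UNIV (\<lambda>_. A) J (Pi\<^sub>E J E)"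
      "\<And>i. i \<in> J \<Longrightarrow> E i \<in> sets A"
    by (auto elim!: prod_algebraE)
  have "emeasure (PiM UNIV (\<lambda>i. f i t)) D = (\<Prod>i\<in>J. emeasure (f i t) (E i))"
    if t: "t \<in> space M" for t
  proof -
    have *: "prob_space (f i t)" "sets (f i t) = sets A" "space (f i t) = space A" for i
      using measurable_space[OF f t] sets_eq_imp_space_eq[of "f i t" A]
      by (auto simp: space_prob_algebra)
    interpret product_prob_space "\<lambda>i. f i t" UNIV
      by (rule product_prob_spaceI) (rule *)
    have "D = prod_emb UNIV (\<lambda>i. f i t) J (Pi\<^sub>E J E)"
      by (simp add: J prod_emb_def *)
    then show ?thesis using J by (simp add: emeasure_PiM_emb *)
  qed
  moreover have "(\<lambda>t. \<Prod>i\<in>J. emeasure (f i t) (E i)) \<in> borel_measurable M"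
    using J by (intro borel_measurable_prod_ennreal
      measurable_compose[OF measurable_prob_algebraD[OF f] measurable_emeasure_subprob_algebra]) auto
  ultimately show "(\<lambda>t. emeasure (PiM UNIV (\<lambda>i. f i t)) D) \<in> borel_measurable M"
    by (simp cong: measurable_cong)
qed

lemma product_mixture_eq:
  assumes l: "\<And>i. l i \<in> ae_classes A" and f: "\<And>i. f i \<in> l i" and D: "D \<in> sets (seq_space A)"
  shows "emeasure (product_mixture l) D = (\<integral>\<^sup>+t. emeasure (PiM UNIV (\<lambda>i. f i t)) D \<partial>unit_leb)"
proof -
  have "unit_leb \<in> space (prob_algebra unit_leb)"
    by (simp add: space_prob_algebra prob_space_unit_leb)
  then have "emeasure (product_mixture l) D =
      (\<integral>\<^sup>+t. emeasure (PiM UNIV (\<lambda>i. representative (l i) t)) D \<partial>unit_leb)"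
    unfolding product_mixture_def
    by (rule emeasure_bind_prob_algebra[OF _ measurable_PiM_kernel D])
       (rule representative_measurable[OF l])
  also have "\<dots> = (\<integral>\<^sup>+t. emeasure (PiM UNIV (\<lambda>i. f i t)) D \<partial>unit_leb)"
  proof (rule nn_integral_cong_AE)
    have "AE t in unit_leb. \<forall>i. representative (l i) t = f i t"
      unfolding AE_all_countable using representative_AE[OF l f] by blast
    then show "AE t in unit_leb. emeasure (PiM UNIV (\<lambda>i. representative (l i) t)) D =
        emeasure (PiM UNIV (\<lambda>i. f i t)) D"
      by eventually_elim simp
  qed
  finally show ?thesis .
qed

lemma product_mixture_in:
  assumes l: "\<And>i. l i \<in> ae_classes A"
  shows "product_mixture l \<in> space (prob_algebra (seq_space A))"
proof -
  have u: "unit_leb \<in> space (prob_algebra unit_leb)"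
    by (simp add: space_prob_algebra prob_space_unit_leb)
  have k: "(\<lambda>t. PiM UNIV (\<lambda>i. representative (l i) t)) \<in> unit_leb \<rightarrow>\<^sub>M prob_algebra (seq_space A)"
    by (rule measurable_PiM_kernel) (rule representative_measurable[OF l])
  have "space unit_leb \<noteq> {}" using prob_space.not_empty[OF prob_space_unit_leb] .
  then show ?thesis
    using prob_space_bind'[OF u k] sets_bind'[OF u k]
    by (simp add: space_prob_algebra product_mixture_def)
qed

end

theory Submission
  imports Defs
begin

text \<open>
  Let \<open>Q\<close> be the law of \<open>\<mu>\<close> and sample \<open>x\<close> from \<open>\<mu>\<close>. Use the even coordinates \<open>y\<close> of \<open>x\<close> as an
  infinite reservoir of conditioning information and represent the law of the odd coordinates
  \<open>z\<^sub>0, z\<^sub>1, \<dots>\<close>, which is again a copy of \<open>\<mu>\<close>. Exchangeability passes from finitary permutations to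
  all injections of indices, since laws are determined by cylinder sets. Hence for an event \<open>C\<close> the conditional
  probabilities of \<open>z\<^sub>k \<in> C\<close> given \<open>(\<mu>, y)\<close> and given \<open>(\<mu>, y, z\<^sub>0, \<dots>, z\<^bsub>k-1\<^esub>)\<close> have the same distribution;
  one being a projection of the other, they coincide. So the \<open>z\<^sub>i\<close> are conditionally independent
  given \<open>(\<mu>, y)\<close>, and \<open>\<lambda>\<^sub>i\<close> is the conditional law of \<open>z\<^sub>i\<close>, where \<open>y\<close> is parametrized by \<open>[0, 1)\<close>. Since this law
  depends only on the joint law of \<open>(z\<^sub>i, y)\<close> under \<open>\<mu>\<close>, permuting the odd coordinates
  permutes the \<open>\<lambda>\<^sub>i\<close>, which makes them exchangeable.
\<close>

section \<open>Standard Borel spaces as retracts of the unit interval\<close>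

text \<open>The mixture built from \<mu> agrees almost surely, on each cylinder, with the marginal
  of \<mu> on the odd coordinates. That marginal usually differs from \<mu>; only its law is the
  same, and this is where equality in law enters. All \<lambda>_i come from one kernel
  \<open>K\<close>, the conditional law of coordinate 0 given \<mu> and the remaining coordinates.
  For \<lambda>_i it is evaluated at \<mu> with its coordinates rearranged as z_i, y_0, y_1, and so
  on. Versions chosen separately for each i would be determined only up to null sets; this choice
  makes the permutation property hold for every \<mu>. Conditioning on \<mu> as well means that
  identities tested against events of \<mu> localize to almost every single \<mu>. Standard Borel
  spaces enter twice, both times through a retraction from [0,1]. For one coordinate, Radon-Nikodym
  densities at rational thresholds are assembled into \<open>K\<close>. For the reservoir, quantile
  functions replace y by a uniform t, jointly measurably in the measure; this t is the variable of
  integration in the claim.\<close>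

definition measurable_retract :: "'a measure \<Rightarrow> 'b measure \<Rightarrow> bool" where
  "measurable_retract A B \<longleftrightarrow>
     (\<exists>\<phi>\<in>A \<rightarrow>\<^sub>M B. \<exists>\<psi>\<in>B \<rightarrow>\<^sub>M A. \<forall>x\<in>space A. \<psi> (\<phi> x) = x)"

lemma measurable_retractI:
  assumes "\<phi> \<in> A \<rightarrow>\<^sub>M B" "\<psi> \<in> B \<rightarrow>\<^sub>M A" "\<And>x. x \<in> space A \<Longrightarrow> \<psi> (\<phi> x) = x"
  shows "measurable_retract A B"
  using assms unfolding measurable_retract_def by blast

lemma measurable_retractE:
  assumes "measurable_retract A B"
  obtains \<phi> \<psi> where "\<phi> \<in> A \<rightarrow>\<^sub>M B" "\<psi> \<in> B \<rightarrow>\<^sub>M A" "\<And>x. x \<in> space A \<Longrightarrow> \<psi> (\<phi> x) = x"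
proof -
  from assms obtain \<phi> \<psi> where "\<phi> \<in> A \<rightarrow>\<^sub>M B" "\<psi> \<in> B \<rightarrow>\<^sub>M A" "\<forall>x\<in>space A. \<psi> (\<phi> x) = x"
    unfolding measurable_retract_def by blast
  then show thesis by (intro that) auto
qed

lemma measurable_retract_trans:
  assumes "measurable_retract A B" "measurable_retract B C"
  shows "measurable_retract A C"
proof -
  from assms(1) obtain \<phi> \<psi> where 1: "\<phi> \<in> A \<rightarrow>\<^sub>M B" "\<psi> \<in> B \<rightarrow>\<^sub>M A"
    "\<And>x. x \<in> space A \<Longrightarrow> \<psi> (\<phi> x) = x" by (elim measurable_retractE) blast
  from assms(2) obtain \<phi>' \<psi>' where 2: "\<phi>' \<in> B \<rightarrow>\<^sub>M C" "\<psi>' \<in> C \<rightarrow>\<^sub>M B"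
    "\<And>x. x \<in> space B \<Longrightarrow> \<psi>' (\<phi>' x) = x" by (elim measurable_retractE) blast
  show ?thesis
    by (rule measurable_retractI[where \<phi> = "\<lambda>x. \<phi>' (\<phi> x)" and \<psi> = "\<lambda>x. \<psi> (\<psi>' x)"])
      (auto simp: 1(3) 2(3) measurable_space[OF 1(1)]
        intro: measurable_compose[OF 1(1) 2(1)] measurable_compose[OF 2(2) 1(2)])
qed

lemma measurable_retract_seq_space:
  assumes "measurable_retract A B"
  shows "measurable_retract (seq_space A) (seq_space B)"
proof -
  from assms obtain \<phi> \<psi> where 1[measurable]: "\<phi> \<in> A \<rightarrow>\<^sub>M B" "\<psi> \<in> B \<rightarrow>\<^sub>M A"
    and 2: "\<And>x. x \<in> space A \<Longrightarrow> \<psi> (\<phi> x) = x" by (elim measurable_retractE) blast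
  show ?thesis
  proof (rule measurable_retractI[where \<phi> = "\<lambda>x n. \<phi> (x n)" and \<psi> = "\<lambda>x n. \<psi> (x n)"])
    show "(\<lambda>x n. \<phi> (x n)) \<in> seq_space A \<rightarrow>\<^sub>M seq_space B"
      by (rule measurable_PiM_single') (auto simp: space_PiM PiE_iff intro: measurable_space[OF 1(1)])
    show "(\<lambda>x n. \<psi> (x n)) \<in> seq_space B \<rightarrow>\<^sub>M seq_space A"
      by (rule measurable_PiM_single') (auto simp: space_PiM PiE_iff intro: measurable_space[OF 1(2)])
  qed (auto simp: space_PiM PiE_iff 2)
qed

lemma measurable_retract_double_seq_space:
  "measurable_retract (seq_space (seq_space B)) (seq_space B)"
proof (rule measurable_retractI[where \<phi> = "\<lambda>x n. x (fst (prod_decode n)) (snd (prod_decode n))"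
      and \<psi> = "\<lambda>x i j. x (prod_encode (i, j))"])
  show "(\<lambda>x n. x (fst (prod_decode n)) (snd (prod_decode n))) \<in> seq_space (seq_space B) \<rightarrow>\<^sub>M seq_space B"
  proof (rule measurable_PiM_single')
    show "(\<lambda>x. x (fst (prod_decode n)) (snd (prod_decode n))) \<in> seq_space (seq_space B) \<rightarrow>\<^sub>M B" for n
      by (rule measurable_compose[where N = "seq_space B" and f = "\<lambda>x. x (fst (prod_decode n))"];
          rule measurable_component_singleton; simp)
  qed (auto simp: space_PiM PiE_iff)
  show "(\<lambda>x i j. x (prod_encode (i, j))) \<in> seq_space B \<rightarrow>\<^sub>M seq_space (seq_space B)"
    by (intro measurable_PiM_single') (auto simp: space_PiM PiE_iff)
qed (auto simp: space_PiM)

text \<open>A real is determined by its Dedekind cut: the bits record which rationals lie above it,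
  and the infimum of those rationals recovers it.\<close>

lemma measurable_retract_real_bits:
  "measurable_retract (borel :: real measure) (seq_space (count_space (UNIV :: bool set)))"
proof (rule measurable_retractI)
  define q :: "nat \<Rightarrow> real" where "q n = real_of_rat (from_nat_into UNIV n)" for n
  \<comment> \<open>False bits contribute \<infinity>, and \<open>real_of_ereal\<close> makes the
    inverse total, so bit sequences that are not cuts also receive a value.\<close>
  let ?\<psi> = "\<lambda>z. real_of_ereal (INF n. if z n then ereal (q n) else \<infinity>)"
  show "(\<lambda>x n. x < q n) \<in> (borel :: real measure) \<rightarrow>\<^sub>M seq_space (count_space (UNIV :: bool set))"
    by (rule measurable_PiM_single') auto
  have [measurable]: "(\<lambda>z. z n) \<in> seq_space (count_space (UNIV :: bool set)) \<rightarrow>\<^sub>M count_space UNIV" for n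
    by (rule measurable_component_singleton) simp
  show "?\<psi> \<in> seq_space (count_space (UNIV :: bool set)) \<rightarrow>\<^sub>M (borel :: real measure)"
    by measurable
  fix x :: real
  have "(INF n. if x < q n then ereal (q n) else \<infinity>) = ereal x"
  proof (rule antisym)
    show "(INF n. if x < q n then ereal (q n) else \<infinity>) \<le> ereal x"
    proof (rule ereal_le_epsilon2)
      fix e :: real assume "0 < e"
      then obtain r where r: "x < real_of_rat r" "real_of_rat r < x + e"
        using of_rat_dense[of x "x + e"] by auto
      obtain n where n: "r = from_nat_into UNIV n"
        using from_nat_into_surj[of "UNIV :: rat set" r] by auto
      have "(INF n. if x < q n then ereal (q n) else \<infinity>) \<le> (if x < q n then ereal (q n) else \<infinity>)"
        by (rule INF_lower) simp
      also have "\<dots> \<le> ereal x + ereal e" using r n by (simp add: q_def)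
      finally show "(INF n. if x < q n then ereal (q n) else \<infinity>) \<le> ereal x + ereal e" .
    qed
    show "ereal x \<le> (INF n. if x < q n then ereal (q n) else \<infinity>)" by (rule INF_greatest) auto
  qed
  then show "?\<psi> (\<lambda>n. x < q n) = x" by simp
qed

text \<open>Cantor set embedding: ternary expansions with digits 0 and 2. The removed middle third
  separates the two possible leading digits, so comparison with 1/2 reads them off
  measurably.\<close>

lemma measurable_retract_bits_unit:
  "measurable_retract (seq_space (count_space (UNIV :: bool set))) (restrict_space borel {0..1::real})"
proof (rule measurable_retractI)
  let ?b = "\<lambda>z n. (if z n then 2 else 0 :: real) / 3 ^ Suc n"
  define e :: "(nat \<Rightarrow> bool) \<Rightarrow> real" where "e z = (\<Sum>n. ?b z n)" for z
  have g: "(\<lambda>n. 2 / 3 ^ Suc n :: real) sums 1"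
    using sums_mult[OF geometric_sums[of "1/3::real"], of "2/3"] by (simp add: power_divide)
  have s: "summable (?b z)" for z
    by (rule summable_comparison_test'[OF sums_summable[OF g], of 0]) auto
  have e0: "0 \<le> e z" for z unfolding e_def by (rule suminf_nonneg[OF s]) auto
  have e1: "e z \<le> 1" for z
    unfolding e_def sums_unique[OF g] by (rule suminf_le[OF _ s sums_summable[OF g]]) auto
  have eS: "3 * e z = (if z 0 then 2 else 0) + e (\<lambda>n. z (Suc n))" for z
  proof -
    have "e z = ?b z 0 + (\<Sum>n. ?b z (Suc n))"
      unfolding e_def using suminf_split_head[OF s[of z]] by simp
    also have "(\<Sum>n. ?b z (Suc n)) = e (\<lambda>n. z (Suc n)) / 3"
      unfolding e_def suminf_divide[OF s, symmetric] by (simp add: field_simps)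
    finally show ?thesis by simp
  qed
  \<comment> \<open>\<open>r n\<close> is the n-fold shift of ternary expansions, which sends x to
    3x minus its leading digit; on the Cantor set that digit is 2 exactly when x is at least
    1/2.\<close>
  define r :: "nat \<Rightarrow> real \<Rightarrow> real" where
    "r = rec_nat (\<lambda>x. x) (\<lambda>_ f x. 3 * f x - (if 1/2 \<le> f x then 2 else 0))"
  have r0: "r 0 x = x" and rS: "r (Suc n) x = 3 * r n x - (if 1/2 \<le> r n x then 2 else 0)" for n x
    by (simp_all add: r_def)
  have bit: "1/2 \<le> e z \<longleftrightarrow> z 0" for z
    using eS[of z] e0[of "\<lambda>n. z (Suc n)"] e1[of "\<lambda>n. z (Suc n)"] by (auto split: if_splits)
  have re: "r n (e z) = e (\<lambda>k. z (k + n))" for n z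
  proof (induction n)
    case (Suc n)
    show ?case unfolding rS Suc bit using eS[of "\<lambda>k. z (k + n)"] by simp
  qed (simp add: r0)
  have [measurable]: "(\<lambda>z. z n) \<in> seq_space (count_space (UNIV :: bool set)) \<rightarrow>\<^sub>M count_space UNIV" for n
    by (rule measurable_component_singleton) simp
  have "e \<in> seq_space (count_space UNIV) \<rightarrow>\<^sub>M borel" unfolding e_def by measurable
  then show "e \<in> seq_space (count_space UNIV) \<rightarrow>\<^sub>M restrict_space borel {0..1}"
    by (rule measurable_restrict_space2[rotated]) (auto simp: e0 e1)
  have rm[measurable]: "r n \<in> borel_measurable borel" for n
  proof (induction n)
    case (Suc n)
    note Suc[measurable]
    show ?case unfolding rS[abs_def] by measurable
  qed (simp add: r0[abs_def])
  show "(\<lambda>x n. 1/2 \<le> r n x) \<in> restrict_space borel {0..1} \<rightarrow>\<^sub>M seq_space (count_space UNIV)"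
    by (intro measurable_restrict_space1 measurable_PiM_single') auto
  fix z :: "nat \<Rightarrow> bool"
  show "(\<lambda>n. 1/2 \<le> r n (e z)) = z" unfolding re bit by simp
qed

text \<open>
  A Polish space embeds into the space of real sequences via the distances to a dense sequence.
  Completeness shows that the image is cut out by the countably many conditions
  \<open>\<bar>z k - z l\<bar> \<le> d (e k) (e l) \<le> z k + z l\<close> and \<open>inf z = 0\<close>, so that it is
  a Borel set and no descriptive set theory is needed.
\<close>

lemma standard_borel_retract_real_seq:
  assumes "standard_borel A" and ne: "space A \<noteq> {}"
  shows "measurable_retract A (seq_space (borel :: real measure))"
proof -
  from assms(1) obtain X where X: "completely_metrizable_space X" "second_countable X"
    "space A = topspace X" "sets A = sigma_sets (topspace X) {U. openin X U}"
    unfolding standard_borel_def by blast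
  from X(1) obtain M d where Md: "Metric_space M d" "Metric_space.mcomplete M d"
      "X = Metric_space.mtopology M d"
    unfolding completely_metrizable_space_def by blast
  interpret Metric_space M d by fact
  have tX: "topspace X = M" by (simp add: Md(3))
  from second_countable_imp_separable_space[OF X(2)] obtain D where
    D: "countable D" "D \<subseteq> M" "X closure_of D = M"
    unfolding separable_space_def tX by auto
  from ne have "D \<noteq> {}" using D X(3) tX by auto
  define e where "e = from_nat_into D"
  have eD: "range e = D" unfolding e_def using D(1) \<open>D \<noteq> {}\<close> by (rule range_from_nat_into[rotated])
  then have eM: "e k \<in> M" for k using D(2) by auto
  have dense: "\<exists>k. d x (e k) < r" if x: "x \<in> M" and r: "0 < r" for x r
  proof -
    have "x \<in> X closure_of D" using x D by simp
    then obtain y where "y \<in> D" "y \<in> mball x r"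
      unfolding Md(3) metric_closure_of using r by blast
    then show ?thesis using eD by (auto simp: in_mball)
  qed
  define B where "B = {z :: nat \<Rightarrow> real. (\<forall>n::nat. \<exists>k. z k < inverse (real (Suc n))) \<and>
    (\<forall>k l. d (e k) (e l) \<le> z k + z l \<and> z k - z l \<le> d (e k) (e l))}"
  have inB: "(\<lambda>k. d x (e k)) \<in> B" if "x \<in> M" for x
  proof -
    have "d (e k) (e l) \<le> d x (e k) + d x (e l)" "d x (e k) \<le> d x (e l) + d (e k) (e l)" for k l
      using triangle[of "e k" x "e l"] triangle[of x "e l" "e k"] that eM by (simp_all add: commute)
    then show ?thesis unfolding B_def using dense[OF that] by (simp add: algebra_simps)
  qed
  have exB: "\<exists>x\<in>M. \<forall>k. z k = d x (e k)" if z: "z \<in> B" for z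
  proof -
    from z have "\<forall>n::nat. \<exists>k. z k < inverse (real (Suc n))" by (simp add: B_def)
    then obtain s where s: "z (s n) < inverse (real (Suc n))" for n by metis
    from z have tri: "d (e k) (e l) \<le> z k + z l" "z k \<le> z l + d (e k) (e l)" for k l
      by (simp_all add: B_def algebra_simps)
    have lim0: "(\<lambda>n. inverse (real (Suc n))) \<longlonglongrightarrow> 0" by (rule LIMSEQ_inverse_real_of_nat)
    \<comment> \<open>Small values of z along s force the points \<open>e (s n)\<close> together,
      because \<open>d (e k) (e l) \<le> z k + z l\<close>. Their limit is the point whose distance
      sequence is z.\<close>
    have "MCauchy (\<lambda>n. e (s n))"
      unfolding MCauchy_def
    proof (intro conjI allI impI)
      fix \<epsilon> :: real assume "0 < \<epsilon>"
      then obtain N where N: "inverse (real (Suc N)) < \<epsilon> / 2" using reals_Archimedean[of "\<epsilon>/2"] by auto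
      show "\<exists>N. \<forall>n n'. N \<le> n \<longrightarrow> N \<le> n' \<longrightarrow> d (e (s n)) (e (s n')) < \<epsilon>"
      proof (intro exI allI impI)
        fix n n' assume "N \<le> n" "N \<le> n'"
        then have "inverse (real (Suc n)) \<le> inverse (real (Suc N))" "inverse (real (Suc n')) \<le> inverse (real (Suc N))"
          by (auto intro!: le_imp_inverse_le)
        then show "d (e (s n)) (e (s n')) < \<epsilon>" using tri(1)[of "s n" "s n'"] s[of n] s[of n'] N by linarith
      qed
    qed (use eM in auto)
    then obtain x where x: "limitin mtopology (\<lambda>n. e (s n)) x sequentially"
      using Md(2) unfolding mcomplete_def by blast
    then have xM: "x \<in> M" by (rule limitin_mspace)
    from x have dx: "(\<lambda>n. d (e (s n)) x) \<longlonglongrightarrow> 0" by (simp add: limitin_metric_dist_null)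
    have "z k = d x (e k)" for k
    proof (rule LIMSEQ_unique)
      have zs: "\<bar>z k - d (e (s n)) (e k)\<bar> \<le> inverse (real (Suc n))" for n
        using tri(1)[of k "s n"] tri(2)[of k "s n"] s[of n] by (auto simp: commute abs_le_iff)
      have "(\<lambda>n. z k - d (e (s n)) (e k)) \<longlonglongrightarrow> 0"
        by (rule Lim_null_comparison[OF _ lim0]) (use zs in auto)
      from tendsto_diff[OF tendsto_const[of "z k"] this]
      show "(\<lambda>n. d (e (s n)) (e k)) \<longlonglongrightarrow> z k" by simp
      have "(\<lambda>n. d (e (s n)) (e k) - d x (e k)) \<longlonglongrightarrow> 0"
      proof (rule Lim_null_comparison[OF _ dx], rule always_eventually, rule allI)
        fix n
        show "norm (d (e (s n)) (e k) - d x (e k)) \<le> d (e (s n)) x"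
          using triangle[of "e (s n)" x "e k"] triangle[of x "e (s n)" "e k"] xM eM
          by (auto simp: commute abs_le_iff)
      qed
      from tendsto_add[OF this tendsto_const[of "d x (e k)"]]
      show "(\<lambda>n. d (e (s n)) (e k)) \<longlonglongrightarrow> d x (e k)" by simp
    qed
    with xM show ?thesis by auto
  qed
  have uniq: "x = y" if "x \<in> M" "y \<in> M" "\<And>k. d x (e k) = d y (e k)" for x y
  proof (rule ccontr)
    assume "x \<noteq> y"
    then have "0 < d x y / 2" using that by (simp add: mdist_pos_eq)
    from dense[OF that(1) this] obtain k where "d x (e k) < d x y / 2" by auto
    then show False using that(3)[of k] triangle[of x "e k" y] that eM by (simp add: commute)
  qed
  obtain a where a: "a \<in> M" using ne X(3) tX by auto
  \<comment> \<open>Outside \<open>B\<close> the value is the fixed point \<open>a\<close>, so there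
    a preimage is all or nothing.\<close>
  define \<psi> where "\<psi> z = (if z \<in> B then SOME x. x \<in> M \<and> (\<forall>k. z k = d x (e k)) else a)" for z
  have psiB: "\<psi> z \<in> M \<and> (\<forall>k. z k = d (\<psi> z) (e k))" if "z \<in> B" for z
    using someI_ex[of "\<lambda>x. x \<in> M \<and> (\<forall>k. z k = d x (e k))"] exB[OF that] that
    unfolding \<psi>_def by auto
  have psia: "\<psi> z = a" if "z \<notin> B" for z using that by (simp add: \<psi>_def)
  have psiM: "\<psi> z \<in> M" for z using psiB[of z] psia[of z] a by (cases "z \<in> B") simp_all
  have [measurable]: "(\<lambda>z. z n) \<in> seq_space borel \<rightarrow>\<^sub>M (borel :: real measure)" for n
    by (rule measurable_component_singleton) simp
  have sp: "space (seq_space (borel :: real measure)) = UNIV" by (simp add: space_PiM)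
  have Bset[measurable]: "B \<in> sets (seq_space borel)"
  proof -
    have "{z \<in> space (seq_space borel). (\<forall>n::nat. \<exists>k. z k < inverse (real (Suc n))) \<and>
      (\<forall>k l. d (e k) (e l) \<le> z k + z l \<and> z k - z l \<le> d (e k) (e l))} \<in> sets (seq_space (borel :: real measure))"
      by measurable
    then show ?thesis by (simp add: B_def sp)
  qed
  show ?thesis
  proof (rule measurable_retractI)
    show "(\<lambda>x k. d x (e k)) \<in> A \<rightarrow>\<^sub>M seq_space borel"
    proof (rule measurable_PiM_single')
      fix k
      have "{x \<in> space A. d x (e k) < r} \<in> sets A" for r
      proof -
        have "{x \<in> space A. d x (e k) < r} = mball (e k) r"
          using eM by (auto simp: X(3) tX in_mball commute)
        then show ?thesis unfolding X(4) Md(3) using openin_mball by (auto intro: sigma_sets.Basic)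
      qed
      then show "(\<lambda>x. d x (e k)) \<in> borel_measurable A" by (simp add: borel_measurable_iff_less)
    qed auto
    show "\<psi> \<in> seq_space borel \<rightarrow>\<^sub>M A"
    proof (rule measurable_sigma_sets[OF X(4)])
      fix U assume "U \<in> {U. openin X U}"
      then have U: "openin X U" by simp
      \<comment> \<open>On \<open>B\<close>, membership of \<open>\<psi> z\<close> in the ball of
        radius r around \<open>e k\<close> just means \<open>z k < r\<close>. As U is a union of
        such balls, the preimage becomes a countable union of coordinate conditions.\<close>
      have *: "\<psi> z \<in> U \<longleftrightarrow> (\<exists>k n. mball (e k) (inverse (real (Suc n))) \<subseteq> U \<and> z k < inverse (real (Suc n)))"
        if z: "z \<in> B" for z
      proof
        assume "\<psi> z \<in> U"
        then obtain r where r: "0 < r" "mball (\<psi> z) r \<subseteq> U"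
          using U psiM unfolding Md(3) openin_mtopology by blast
        then obtain n where n: "inverse (real (Suc n)) < r / 2" using reals_Archimedean[of "r/2"] by auto
        obtain k where k: "d (\<psi> z) (e k) < inverse (real (Suc n))" using dense[OF psiM] by force
        have "mball (e k) (inverse (real (Suc n))) \<subseteq> mball (\<psi> z) r"
        proof
          fix y assume "y \<in> mball (e k) (inverse (real (Suc n)))"
          then show "y \<in> mball (\<psi> z) r"
            using triangle[of "\<psi> z" "e k" y] psiM[of z] eM[of k] k n by (auto simp: in_mball)
        qed
        then show "\<exists>k n. mball (e k) (inverse (real (Suc n))) \<subseteq> U \<and> z k < inverse (real (Suc n))"
          using r k psiB[OF z] by (metis order.trans)
      next
        assume "\<exists>k n. mball (e k) (inverse (real (Suc n))) \<subseteq> U \<and> z k < inverse (real (Suc n))"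
        then obtain k n where kn: "mball (e k) (inverse (real (Suc n))) \<subseteq> U" "z k < inverse (real (Suc n))"
          by blast
        then have "\<psi> z \<in> mball (e k) (inverse (real (Suc n)))"
          using psiB[OF z] eM by (auto simp: in_mball commute)
        with kn show "\<psi> z \<in> U" by blast
      qed
      have "\<psi> -` U \<inter> space (seq_space borel) = {z \<in> space (seq_space borel).
          (z \<in> B \<and> (\<exists>k n. mball (e k) (inverse (real (Suc n))) \<subseteq> U \<and> z k < inverse (real (Suc n)))) \<or>
          (z \<notin> B \<and> a \<in> U)}"
      proof -
        have "\<psi> z \<in> U \<longleftrightarrow> (z \<in> B \<and> (\<exists>k n. mball (e k) (inverse (real (Suc n))) \<subseteq> U \<and> z k < inverse (real (Suc n)))) \<or>
          (z \<notin> B \<and> a \<in> U)" for z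
          using *[of z] psia[of z] by (cases "z \<in> B") simp_all
        then show ?thesis unfolding vimage_def by blast
      qed
      also have "\<dots> \<in> sets (seq_space borel)" by measurable
      finally show "\<psi> -` U \<inter> space (seq_space borel) \<in> sets (seq_space borel)" .
    qed (use psiM tX openin_subset[of X] in auto)
    fix x assume "x \<in> space A"
    then have x: "x \<in> M" using X(3) tX by simp
    show "\<psi> (\<lambda>k. d x (e k)) = x"
    proof (rule uniq[OF psiM x])
      show "d (\<psi> (\<lambda>k. d x (e k))) (e k) = d x (e k)" for k
        using psiB[OF inB[OF x]] by metis
    qed
  qed
qed

text \<open>The first retract serves the disintegration of a single coordinate, the second the
  parametrization of the whole reservoir by one uniform variable.\<close>

lemma standard_borel_retract_unit:
  assumes "standard_borel A" "space A \<noteq> {}"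
  shows "measurable_retract A (restrict_space borel {0..1::real})"
    and "measurable_retract (seq_space A) (restrict_space borel {0..1::real})"
proof -
  have R: "measurable_retract (seq_space (borel :: real measure)) (restrict_space borel {0..1::real})"
    using measurable_retract_seq_space[OF measurable_retract_real_bits]
      measurable_retract_double_seq_space measurable_retract_bits_unit
    by (blast intro: measurable_retract_trans)
  have A: "measurable_retract A (seq_space (borel :: real measure))"
    by (rule standard_borel_retract_real_seq) fact+
  from A R show "measurable_retract A (restrict_space borel {0..1::real})"
    by (rule measurable_retract_trans)
  from measurable_retract_seq_space[OF A] measurable_retract_double_seq_space R
  show "measurable_retract (seq_space A) (restrict_space borel {0..1::real})"
    by (blast intro: measurable_retract_trans)
qed

section \<open>Quantile functions and disintegration\<close>

text \<open>Tested on the set where \<open>g < f\<close>, the hypothesis forces the excess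
  \<open>f - g\<close> to integrate to zero. Finiteness of the integral of f permits the
  cancellation in \<open>ennreal\<close>.\<close>

lemma AE_le_if_set_nn_integral_le:
  assumes [measurable]: "f \<in> borel_measurable M" "g \<in> borel_measurable M"
    and fin: "(\<integral>\<^sup>+x. f x \<partial>M) < \<infinity>"
    and le: "\<And>B. B \<in> sets M \<Longrightarrow> (\<integral>\<^sup>+x\<in>B. f x \<partial>M) \<le> (\<integral>\<^sup>+x\<in>B. g x \<partial>M)"
  shows "AE x in M. f x \<le> (g x :: ennreal)"
proof -
  define B where "B = {x \<in> space M. g x < f x}"
  have B[measurable]: "B \<in> sets M" unfolding B_def by measurable
  have gf: "(\<integral>\<^sup>+x\<in>B. g x \<partial>M) \<le> (\<integral>\<^sup>+x. f x \<partial>M)"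
    by (rule nn_integral_mono) (auto simp: B_def indicator_def)
  have "(\<integral>\<^sup>+x\<in>B. (f x - g x) \<partial>M) + (\<integral>\<^sup>+x\<in>B. g x \<partial>M) = (\<integral>\<^sup>+x\<in>B. f x \<partial>M)"
    by (subst nn_integral_add[symmetric])
      (auto intro!: nn_integral_cong simp: B_def indicator_def diff_add_cancel_ennreal)
  also have "\<dots> \<le> (\<integral>\<^sup>+x\<in>B. g x \<partial>M)" by (rule le[OF B])
  finally have "(\<integral>\<^sup>+x\<in>B. g x \<partial>M) + (\<integral>\<^sup>+x\<in>B. (f x - g x) \<partial>M) \<le> (\<integral>\<^sup>+x\<in>B. g x \<partial>M) + 0"
    by (simp add: add.commute)
  moreover have "(\<integral>\<^sup>+x\<in>B. g x \<partial>M) \<noteq> \<infinity>" using le_less_trans[OF gf fin] by simp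
  ultimately have "(\<integral>\<^sup>+x\<in>B. (f x - g x) \<partial>M) = 0"
    by (metis ennreal_add_left_cancel_le le_zero_eq)
  then have "AE x in M. (f x - g x) * indicator B x = 0"
    by (subst (asm) nn_integral_0_iff_AE) measurable
  then show ?thesis
    using AE_space
  proof eventually_elim
    case (elim x)
    show ?case
    proof (rule ccontr)
      assume "\<not> f x \<le> g x"
      then have "x \<in> B" "0 < f x - g x"
        using elim(2) by (simp_all add: B_def diff_gt_0_iff_gt_ennreal not_le)
      with elim(1) show False by simp
    qed
  qed
qed

lemma AE_eq_if_set_nn_integral_eq:
  assumes [measurable]: "f \<in> borel_measurable M" "g \<in> borel_measurable M"
    and fin: "(\<integral>\<^sup>+x. f x \<partial>M) < \<infinity>"
    and eq: "\<And>B. B \<in> sets M \<Longrightarrow> (\<integral>\<^sup>+x\<in>B. f x \<partial>M) = (\<integral>\<^sup>+x\<in>B. g x \<partial>M)"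
  shows "AE x in M. f x = (g x :: ennreal)"
proof -
  have "(\<integral>\<^sup>+x. f x \<partial>M) = (\<integral>\<^sup>+x\<in>space M. f x \<partial>M)" "(\<integral>\<^sup>+x. g x \<partial>M) = (\<integral>\<^sup>+x\<in>space M. g x \<partial>M)"
    by (auto intro!: nn_integral_cong)
  with eq[of "space M"] fin have fin': "(\<integral>\<^sup>+x. g x \<partial>M) < \<infinity>" by (metis sets.top)
  have "AE x in M. f x \<le> g x"
    by (rule AE_le_if_set_nn_integral_le[OF _ _ fin]) (simp_all add: eq)
  moreover have "AE x in M. g x \<le> f x"
    by (rule AE_le_if_set_nn_integral_le[OF _ _ fin']) (simp_all add: eq)
  ultimately show ?thesis by eventually_elim simp
qed

text \<open>Strict half-lines are chosen because \<open>quantile_less_iff\<close> describes the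
  events \<open>quantile f t < x\<close>.\<close>

lemma finite_measure_eqI_lessThan:
  fixes M N :: "real measure"
  assumes "sets M = sets borel" "sets N = sets borel" "finite_measure M"
    and eq: "\<And>x. emeasure M {..<x} = emeasure N {..<x}"
  shows "M = N"
proof (rule measure_eqI_generator_eq[where E = "range lessThan" and \<Omega> = UNIV and A = "\<lambda>n. {..<real n}"])
  have "sets (borel :: real measure) = sigma_sets UNIV (range lessThan)"
    by (subst borel_eq_lessThan) (simp add: eucl_lessThan)
  then show "sets M = sigma_sets UNIV (range lessThan)" "sets N = sigma_sets UNIV (range lessThan)"
    using assms(1,2) by auto
  show "(\<Union>n. {..<real n}) = UNIV" by (auto intro: reals_Archimedean2)
  interpret finite_measure M by fact
  show "emeasure M {..<real n} \<noteq> \<infinity>" for n by simp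
  have "{..<a} \<inter> {..<b} \<in> range lessThan" for a b :: real by (rule image_eqI[of _ _ "min a b"]) auto
  then show "Int_stable (range lessThan :: real set set)" by (auto simp: Int_stable_def)
qed (auto simp: eq)

text \<open>
  The point \<open>1\<close> and the restriction to \<open>[0, 1]\<close> keep the infimum meaningful for every \<open>f\<close>, so that
  no exceptional null set has to be removed when \<open>f\<close> is only almost surely a distribution function.
\<close>

definition quantile :: "(rat \<Rightarrow> ennreal) \<Rightarrow> real \<Rightarrow> real" where
  "quantile f t = Inf (insert 1 (of_rat ` {q \<in> {0..1}. ennreal t < f q}))"

text \<open>An infimum lies strictly below x iff some member does. The event is thus a countable
  condition on f and t, which yields joint measurability; for \<open>x \<le> 1\<close> the added
  point 1 never counts.\<close>

lemma quantile_less_iff: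
  assumes "x \<le> 1"
  shows "quantile f t < x \<longleftrightarrow> (\<exists>q\<in>{0..1}. of_rat q < x \<and> ennreal t < f q)"
proof -
  have "bdd_below (insert 1 (of_rat ` {q \<in> {0..1}. ennreal t < f q}) :: real set)"
    by (rule bdd_belowI[of _ 0]) auto
  then show ?thesis unfolding quantile_def using assms by (subst cInf_less_iff) auto
qed

lemma quantile_le_1: "quantile f t \<le> 1"
  unfolding quantile_def by (rule cInf_lower) (auto intro: bdd_belowI[of _ 0])

lemma borel_measurable_quantile:
  assumes "\<And>q. (\<lambda>s. f s q) \<in> borel_measurable S"
  shows "(\<lambda>(s, t). quantile (f s) t) \<in> borel_measurable (S \<Otimes>\<^sub>M unit_leb)"
proof (subst borel_measurable_iff_less, intro allI)
  fix x :: real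
  note assms[measurable]
  have [measurable]: "(\<lambda>t. t) \<in> borel_measurable unit_leb"
    unfolding unit_leb_def by (rule measurable_restrict_space1) simp
  show "{w \<in> space (S \<Otimes>\<^sub>M unit_leb). (case w of (s, t) \<Rightarrow> quantile (f s) t) < x} \<in> sets (S \<Otimes>\<^sub>M unit_leb)"
  proof (cases "x \<le> 1")
    case True
    have "{w \<in> space (S \<Otimes>\<^sub>M unit_leb). \<exists>q\<in>{0..1}. of_rat q < x \<and> ennreal (snd w) < f (fst w) q}
        \<in> sets (S \<Otimes>\<^sub>M unit_leb)"
      by measurable
    then show ?thesis using True by (simp add: quantile_less_iff case_prod_unfold)
  next
    case False
    then have "{w \<in> space (S \<Otimes>\<^sub>M unit_leb). (case w of (s, t) \<Rightarrow> quantile (f s) t) < x} = space (S \<Otimes>\<^sub>M unit_leb)"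
      by (auto simp: case_prod_unfold not_le intro: le_less_trans[OF quantile_le_1])
    then show ?thesis by simp
  qed
qed

lemma space_unit_leb: "space unit_leb = {0..<1}"
  by (simp add: unit_leb_def)

lemma emeasure_unit_leb_less: "emeasure unit_leb {t \<in> space unit_leb. ennreal t < c} = min 1 c"
proof -
  have "{t \<in> space unit_leb. ennreal t < c} = {0..<enn2real (min 1 c)}"
  proof (cases "c = \<top>")
    case False
    then have "c < \<top>" by (simp add: top.not_eq_extremum)
    then obtain r where r: "c = ennreal r" "0 \<le> r" by (metis ennreal_enn2real enn2real_nonneg)
    have "min 1 c = ennreal (min 1 r)" unfolding r
      using min_ennreal[of 1 r] r(2) by simp
    then have "enn2real (min 1 c) = min 1 r" using r by simp
    then show ?thesis using r by (auto simp: space_unit_leb ennreal_less_iff)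
  qed (auto simp: space_unit_leb)
  moreover have "enn2real (min 1 c) \<le> 1" by (simp add: enn2real_leI min_def)
  moreover have "min 1 c < \<top>" by (rule le_less_trans[OF min.cobounded1]) simp
  then have "ennreal (enn2real (min 1 c)) = min 1 c" by simp
  ultimately show ?thesis
    unfolding unit_leb_def by (subst emeasure_restrict_space) auto
qed

text \<open>For each q the condition \<open>ennreal t < f q\<close> cuts out an initial segment of
  [0,1), so the union over q is the initial segment up to the supremum, truncated at 1.\<close>

lemma emeasure_quantile_less:
  assumes "x \<le> 1"
  shows "emeasure unit_leb {t \<in> space unit_leb. quantile f t < x} =
    min 1 (SUP q\<in>{q \<in> {0..1}. of_rat q < x}. f q)"
proof -
  have "{t \<in> space unit_leb. quantile f t < x} =
      {t \<in> space unit_leb. ennreal t < (SUP q\<in>{q \<in> {0..1}. of_rat q < x}. f q)}"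
    using assms by (auto simp: quantile_less_iff less_SUP_iff)
  then show ?thesis by (simp add: emeasure_unit_leb_less)
qed

lemma countable_cofinal_incseq:
  fixes I :: "'b::linorder set"
  assumes "countable I" "I \<noteq> {}"
  obtains s :: "nat \<Rightarrow> 'b" where "incseq s" "range s \<subseteq> I" "\<And>q. q \<in> I \<Longrightarrow> \<exists>n. q \<le> s n"
proof
  let ?s = "\<lambda>n. Max (from_nat_into I ` {..n})"
  show "incseq ?s" by (auto simp: incseq_def intro!: Max_mono)
  have "?s n \<in> from_nat_into I ` {..n}" for n by (rule Max_in) auto
  moreover have "from_nat_into I ` {..n} \<subseteq> I" for n using from_nat_into[OF assms(2)] by auto
  ultimately show "range ?s \<subseteq> I" by (intro image_subsetI) (metis subsetD)
  show "\<exists>n. q \<le> ?s n" if "q \<in> I" for q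
    using from_nat_into_surj[OF assms(1) that] by (metis Max_ge atMost_iff finite_atMost finite_imageI imageI order_refl)
qed

lemma measurable_quantile: "quantile f \<in> borel_measurable unit_leb"
  using measurable_Pair2[OF borel_measurable_quantile[of "\<lambda>_. f" "count_space {()}"], of "()"]
  by simp

lemma emeasure_distr_quantile:
  "emeasure (distr unit_leb borel (quantile f)) {..<x} = emeasure unit_leb {t \<in> space unit_leb. quantile f t < x}"
proof -
  have "quantile f -` {..<x} \<inter> space unit_leb = {t \<in> space unit_leb. quantile f t < x}" by blast
  then show ?thesis by (simp only: emeasure_distr[OF measurable_quantile] lessThan_borel)
qed

lemma prob_space_distr_quantile: "prob_space (distr unit_leb borel (quantile f))"
  by (rule prob_space.prob_space_distr[OF prob_space_unit_leb measurable_quantile])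

lemma emeasure_distr_quantile_nonpos:
  assumes "x \<le> 0"
  shows "emeasure (distr unit_leb borel (quantile f)) {..<x} = 0"
proof -
  have "{q \<in> {0..1}. real_of_rat q < x} = {}"
    by (auto simp: not_less intro: order_trans[OF assms])
  moreover have "emeasure unit_leb {t \<in> space unit_leb. quantile f t < x} =
      min 1 (SUP q\<in>{q \<in> {0..1}. of_rat q < x}. f q)"
    using assms by (intro emeasure_quantile_less) simp
  ultimately show ?thesis by (simp only: emeasure_distr_quantile) (simp add: bot_ennreal)
qed

lemma emeasure_distr_quantile_gt_1:
  assumes "1 < x"
  shows "emeasure (distr unit_leb borel (quantile f)) {..<x} = 1"
proof -
  have "{t \<in> space unit_leb. quantile f t < x} = space unit_leb"
    using assms by (auto intro: le_less_trans[OF quantile_le_1])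
  then show ?thesis
    by (simp add: emeasure_distr_quantile prob_space.emeasure_space_1[OF prob_space_unit_leb])
qed

text \<open>The sequence is cofinal among the rationals of [0,1] below x. Since s is fixed before y
  and f, it approximates the half-line from inside and evaluates the quantile laws of all fibres at
  once, so that continuity along a single index suffices.\<close>

lemma rat_approx_below:
  fixes x :: real
  assumes x: "0 < x" "x \<le> 1"
  obtains s :: "nat \<Rightarrow> rat" where
    "incseq s"
    "\<forall>y\<ge>0. y < x \<longleftrightarrow> (\<exists>n. y \<le> of_rat (s n))"
    "\<forall>f. mono f \<longrightarrow> (\<forall>q. f q \<le> 1) \<longrightarrow>
      emeasure (distr unit_leb borel (quantile f)) {..<x} = (SUP n. f (s n))"
proof -
  let ?I = "{q \<in> {0..1}. real_of_rat q < x}"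
  have ne: "?I \<noteq> {}" using x by (auto intro!: exI[of _ 0])
  obtain s where s: "incseq s" "range s \<subseteq> ?I" "\<And>q. q \<in> ?I \<Longrightarrow> \<exists>n. q \<le> s n"
    by (rule countable_cofinal_incseq[OF _ ne]) auto
  have 2: "y < x \<longleftrightarrow> (\<exists>n. y \<le> of_rat (s n))" if "0 \<le> y" for y
  proof
    assume "y < x"
    then obtain q where q: "y < of_rat q" "of_rat q < x" using of_rat_dense[of y x] by auto
    have "0 < real_of_rat q" "real_of_rat q < 1"
      using q that x by linarith+
    with q(2) have "q \<in> ?I" by simp
    from s(3)[OF this] obtain n where "real_of_rat q \<le> of_rat (s n)" by (auto simp: of_rat_less_eq)
    with q show "\<exists>n. y \<le> of_rat (s n)" by (auto intro!: exI[of _ n])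
  next
    assume "\<exists>n. y \<le> of_rat (s n)"
    then obtain n where "y \<le> of_rat (s n)" by blast
    also have "\<dots> < x" using s(2) by auto
    finally show "y < x" .
  qed
  have 3: "emeasure (distr unit_leb borel (quantile f)) {..<x} = (SUP n. f (s n))"
    if f: "mono f" "\<And>q. f q \<le> 1" for f
  proof -
    have "(SUP q\<in>?I. f q) = (SUP n. f (s n))"
    proof (rule antisym)
      show "(SUP q\<in>?I. f q) \<le> (SUP n. f (s n))"
      proof (rule SUP_mono)
        fix q assume "q \<in> ?I"
        from s(3)[OF this] obtain n where "q \<le> s n" by auto
        then have "f q \<le> f (s n)" using f(1) by (simp add: monoD)
        then show "\<exists>n\<in>UNIV. f q \<le> f (s n)" by blast
      qed
      have "s n \<in> ?I" for n using s(2) by blast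
      then show "(SUP n. f (s n)) \<le> (SUP q\<in>?I. f q)" by (intro SUP_mono) blast
    qed
    moreover have "(SUP n. f (s n)) \<le> 1" using f(2) by (intro SUP_least)
    ultimately show ?thesis
      using x(2) by (simp add: emeasure_distr_quantile emeasure_quantile_less min_absorb2)
  qed
  show thesis using that s(1) 2 3 by blast
qed

text \<open>Inverse transform sampling. The values of the distribution function at rationals below x
  increase to the mass of the open half-line, by continuity from below.\<close>

lemma distr_quantile_cdf:
  fixes N :: "real measure"
  assumes N: "prob_space N" "sets N = sets borel" and out: "AE y in N. 0 \<le> y \<and> y \<le> 1"
  shows "distr unit_leb borel (quantile (\<lambda>q. emeasure N {..of_rat q})) = N"
proof (rule finite_measure_eqI_lessThan)
  interpret N: prob_space N by fact
  let ?f = "\<lambda>q. emeasure N {..of_rat q}"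
  have spN: "space N = UNIV" using sets_eq_imp_space_eq[OF N(2)] by simp
  show "finite_measure (distr unit_leb borel (quantile ?f))"
    using prob_space_distr_quantile by (rule prob_space.finite_measure)
  fix x :: real
  consider "1 < x" | "x \<le> 0" | "0 < x" "x \<le> 1" by linarith
  then show "emeasure (distr unit_leb borel (quantile ?f)) {..<x} = emeasure N {..<x}"
  proof cases
    case 1
    have "emeasure N {..<x} = emeasure N (space N)"
    proof (rule emeasure_eq_AE)
      show "AE y in N. y \<in> {..<x} \<longleftrightarrow> y \<in> space N"
        using out by eventually_elim (use 1 in \<open>simp add: spN\<close>)
    qed (simp_all add: N(2) spN)
    then show ?thesis using 1 by (simp add: emeasure_distr_quantile_gt_1 N.emeasure_space_1)
  next
    case 2
    have "emeasure N {..<x} = emeasure N {}"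
    proof (rule emeasure_eq_AE)
      show "AE y in N. y \<in> {..<x} \<longleftrightarrow> y \<in> {}"
        using out by eventually_elim (use 2 in simp)
    qed (simp_all add: N(2))
    then show ?thesis using 2 by (simp add: emeasure_distr_quantile_nonpos)
  next
    case 3
    then obtain s :: "nat \<Rightarrow> rat" where s0: "incseq s"
      "\<forall>y\<ge>0. y < x \<longleftrightarrow> (\<exists>n. y \<le> of_rat (s n))"
      "\<forall>f. mono f \<longrightarrow> (\<forall>q. f q \<le> 1) \<longrightarrow>
        emeasure (distr unit_leb borel (quantile f)) {..<x} = (SUP n. f (s n))"
      by (rule rat_approx_below) blast
    note s = s0(1) s0(2)[rule_format] s0(3)[rule_format]
    have "emeasure (distr unit_leb borel (quantile ?f)) {..<x} = (SUP n. ?f (s n))"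
      by (rule s(3)) (auto simp: mono_def N(2) of_rat_less_eq N.measure_le_1 intro!: emeasure_mono)
    also have "\<dots> = emeasure N (\<Union>n. {..real_of_rat (s n)})"
      using s(1) by (intro SUP_emeasure_incseq) (auto simp: incseq_def of_rat_less_eq N(2))
    also have "\<dots> = emeasure N {..<x}"
    proof (rule emeasure_eq_AE)
      show "AE y in N. y \<in> (\<Union>n. {..real_of_rat (s n)}) \<longleftrightarrow> y \<in> {..<x}"
        using out by eventually_elim (simp add: s(2))
    qed (simp_all add: N(2))
    finally show ?thesis .
  qed
qed (use N in auto)

section \<open>Transport from the unit interval to standard Borel spaces\<close>

lemma measurable_retract_unitE:
  assumes "measurable_retract A (restrict_space borel {0..1::real})"
  obtains \<phi> :: "'a \<Rightarrow> real" and \<psi> where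
    "\<phi> \<in> borel_measurable A" "\<And>x. x \<in> space A \<Longrightarrow> 0 \<le> \<phi> x \<and> \<phi> x \<le> 1"
    "\<psi> \<in> borel \<rightarrow>\<^sub>M A" "\<And>x. x \<in> space A \<Longrightarrow> \<psi> (\<phi> x) = x"
proof -
  from assms obtain \<phi> :: "'a \<Rightarrow> real" and \<psi> where
    1: "\<phi> \<in> A \<rightarrow>\<^sub>M restrict_space borel {0..1}" "\<psi> \<in> restrict_space borel {0..1} \<rightarrow>\<^sub>M A"
      "\<And>x. x \<in> space A \<Longrightarrow> \<psi> (\<phi> x) = x"
    by (elim measurable_retractE) blast
  have 2: "0 \<le> \<phi> x \<and> \<phi> x \<le> 1" if "x \<in> space A" for x
    using measurable_space[OF 1(1) that] by simp
  \<comment> \<open>Clamping extends the left inverse to all of \<open>borel\<close>, so that laws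
    on the real line can be pushed back directly.\<close>
  have "(\<lambda>r. max 0 (min 1 r)) \<in> borel \<rightarrow>\<^sub>M restrict_space borel {0..1::real}"
    by (rule measurable_restrict_space2) auto
  from measurable_compose[OF this 1(2)] have 3: "(\<lambda>r. \<psi> (max 0 (min 1 r))) \<in> borel \<rightarrow>\<^sub>M A" .
  show thesis
  proof (rule that[OF _ 2 3])
    show "\<phi> \<in> borel_measurable A" using 1(1) by (simp add: measurable_restrict_space2_iff)
    show "\<psi> (max 0 (min 1 (\<phi> x))) = x" if "x \<in> space A" for x
      using 2[OF that] 1(3)[OF that] by (simp add: max_absorb2 min_absorb2)
  qed
qed

text \<open>Joint measurability in \<nu> and t is the point: it lets one uniform variable imitate a
  sample from a measure that itself varies. The map is the quantile function of the image law in
  [0,1], followed by the retraction.\<close>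

lemma measurable_parametrization:
  assumes "measurable_retract A (restrict_space borel {0..1::real})"
  obtains h where "h \<in> prob_algebra A \<Otimes>\<^sub>M unit_leb \<rightarrow>\<^sub>M A"
    "\<And>\<nu>. \<nu> \<in> space (prob_algebra A) \<Longrightarrow> distr unit_leb A (\<lambda>t. h (\<nu>, t)) = \<nu>"
proof -
  from assms obtain \<phi> :: "'a \<Rightarrow> real" and \<psi> where
    phi[measurable]: "\<phi> \<in> borel_measurable A" and phi01: "\<And>x. x \<in> space A \<Longrightarrow> 0 \<le> \<phi> x \<and> \<phi> x \<le> 1"
    and psi[measurable]: "\<psi> \<in> borel \<rightarrow>\<^sub>M A" and inv: "\<And>x. x \<in> space A \<Longrightarrow> \<psi> (\<phi> x) = x"
    by (rule measurable_retract_unitE) blast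
  define f where "f \<nu> q = emeasure (distr \<nu> borel \<phi>) {..of_rat q}" for \<nu> and q :: rat
  have "(\<lambda>\<nu>. f \<nu> q) \<in> borel_measurable (prob_algebra A)" for q
    unfolding f_def
    by (rule measurable_compose[OF measurable_prob_algebraD[OF measurable_distr_prob_space[OF phi]]
          measurable_emeasure_subprob_algebra]) simp
  then have q: "(\<lambda>(\<nu>, t). quantile (f \<nu>) t) \<in> borel_measurable (prob_algebra A \<Otimes>\<^sub>M unit_leb)"
    by (rule borel_measurable_quantile)
  show thesis
  proof (rule that)
    show "(\<lambda>w. \<psi> ((\<lambda>(\<nu>, t). quantile (f \<nu>) t) w)) \<in> prob_algebra A \<Otimes>\<^sub>M unit_leb \<rightarrow>\<^sub>M A"
      using q psi by (rule measurable_compose)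
    fix \<nu> assume "\<nu> \<in> space (prob_algebra A)"
    then have nu: "prob_space \<nu>" "sets \<nu> = sets A" by (simp_all add: space_prob_algebra)
    note [measurable_cong] = nu(2)
    have phi': "\<phi> \<in> borel_measurable \<nu>" by measurable
    have spn: "space \<nu> = space A" using nu(2) by (rule sets_eq_imp_space_eq)
    have "distr unit_leb A (\<lambda>t. \<psi> (quantile (f \<nu>) t)) = distr (distr unit_leb borel (quantile (f \<nu>))) A \<psi>"
      by (subst distr_distr[OF psi measurable_quantile]) (simp add: comp_def)
    also have "distr unit_leb borel (quantile (f \<nu>)) = distr \<nu> borel \<phi>"
      unfolding f_def
    proof (rule distr_quantile_cdf)
      show "prob_space (distr \<nu> borel \<phi>)" by (rule prob_space.prob_space_distr[OF nu(1) phi'])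
      show "AE y in distr \<nu> borel \<phi>. 0 \<le> y \<and> y \<le> 1"
        by (subst AE_distr_iff[OF phi']) (auto simp: spn phi01 intro!: AE_I2)
    qed simp
    also have "distr (distr \<nu> borel \<phi>) A \<psi> = distr \<nu> A (\<lambda>x. \<psi> (\<phi> x))"
      by (subst distr_distr[OF psi phi']) (simp add: comp_def)
    also have "\<dots> = distr \<nu> \<nu> (\<lambda>x. x)"
      by (rule distr_cong) (simp_all add: nu(2) spn inv)
    finally show "distr unit_leb A (\<lambda>t. \<psi> ((\<lambda>(\<nu>, t). quantile (f \<nu>) t) (\<nu>, t))) = \<nu>" by simp
  qed
qed

text \<open>Regular conditional law of the second coordinate. For rational q, the mass of B times
  the event \<open>\<phi> \<le> q\<close> is a measure in B with a density \<open>f q\<close>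
  against the first marginal. These densities almost surely form a subdistribution function in q,
  which \<open>quantile\<close> turns into a law.\<close>

lemma disintegration_exists:
  assumes R: "measurable_retract A (restrict_space borel {0..1::real})"
    and P: "prob_space P" "sets P = sets (S \<Otimes>\<^sub>M A)"
  obtains K where "K \<in> S \<rightarrow>\<^sub>M prob_algebra A"
    "\<And>B C. B \<in> sets S \<Longrightarrow> C \<in> sets A \<Longrightarrow>
      emeasure P (B \<times> C) = (\<integral>\<^sup>+s\<in>B. emeasure (K s) C \<partial>distr P S fst)"
proof -
  interpret P: prob_space P by fact
  note [measurable_cong] = P(2)
  have spP: "space P = space S \<times> space A"
    using sets_eq_imp_space_eq[OF P(2)] by (simp add: space_pair_measure)
  from R obtain \<phi> :: "'a \<Rightarrow> real" and \<psi> where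
    phi[measurable]: "\<phi> \<in> borel_measurable A" and phi01: "\<And>x. x \<in> space A \<Longrightarrow> 0 \<le> \<phi> x \<and> \<phi> x \<le> 1"
    and psi[measurable]: "\<psi> \<in> borel \<rightarrow>\<^sub>M A" and inv: "\<And>x. x \<in> space A \<Longrightarrow> \<psi> (\<phi> x) = x"
    by (rule measurable_retract_unitE) blast
  define PS where "PS = distr P S fst"
  have fst_m: "fst \<in> P \<rightarrow>\<^sub>M S" by measurable
  interpret PS: prob_space PS unfolding PS_def by (rule P.prob_space_distr[OF fst_m])
  have sPS[measurable_cong]: "sets PS = sets S" by (simp add: PS_def)
  have spPS: "space PS = space S" by (simp add: PS_def)
  define D where "D q = {w \<in> space P. \<phi> (snd w) \<le> of_rat q}" for q :: rat
  have D[measurable]: "D q \<in> sets P" for q unfolding D_def by measurable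
  define Pq where "Pq q = distr (density P (indicator (D q))) S fst" for q
  have Pq: "emeasure (Pq q) B = emeasure P {w \<in> space P. fst w \<in> B \<and> \<phi> (snd w) \<le> of_rat q}"
    if B[measurable]: "B \<in> sets S" for q B
  proof -
    have "emeasure (Pq q) B = emeasure P (D q \<inter> (fst -` B \<inter> space P))"
      unfolding Pq_def by (subst emeasure_distr) (simp_all add: emeasure_restricted)
    also have "D q \<inter> (fst -` B \<inter> space P) = {w \<in> space P. fst w \<in> B \<and> \<phi> (snd w) \<le> of_rat q}"
      by (auto simp: D_def)
    finally show ?thesis .
  qed
  have PSB: "emeasure PS B = emeasure P (fst -` B \<inter> space P)" if "B \<in> sets S" for B
    unfolding PS_def using fst_m that by (rule emeasure_distr)
  have "\<exists>f\<in>borel_measurable PS. density PS f = Pq q" for q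
  proof (rule PS.Radon_Nikodym)
    show "absolutely_continuous PS (Pq q)"
      unfolding absolutely_continuous_def null_sets_def
    proof safe
      fix B assume B: "B \<in> sets PS" "emeasure PS B = 0"
      then have B': "B \<in> sets S" by (simp add: sPS)
      then show "B \<in> sets (Pq q)" by (simp add: Pq_def)
      have [measurable]: "fst -` B \<inter> space P \<in> sets P" using fst_m B' by (rule measurable_sets)
      have "emeasure (Pq q) B \<le> emeasure PS B"
        unfolding Pq[OF B'] PSB[OF B'] by (rule emeasure_mono) auto
      with B show "emeasure (Pq q) B = 0" by simp
    qed
  qed (simp add: Pq_def sPS)
  then obtain f where f0: "\<And>q. f q \<in> borel_measurable PS" "\<And>q. density PS (f q) = Pq q" by metis
  have [measurable]: "f q \<in> borel_measurable S" for q
    using f0(1)[of q] measurable_cong_sets[OF sPS refl] by blast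
  have f: "(\<integral>\<^sup>+s\<in>B. f q s \<partial>PS) = emeasure P {w \<in> space P. fst w \<in> B \<and> \<phi> (snd w) \<le> of_rat q}"
    if "B \<in> sets S" for q B
    using that f0(2)[of q] Pq[OF that, of q] f0(1)[of q]
    by (metis emeasure_density sPS)
  have set_m[measurable]: "{w \<in> space P. fst w \<in> B \<and> \<phi> (snd w) \<le> r} \<in> sets P"
    if "B \<in> sets S" for B and r :: real
    using that by measurable
  have fle: "(\<integral>\<^sup>+s\<in>B. f q s \<partial>PS) \<le> emeasure PS B" if "B \<in> sets S" for q B
    unfolding f[OF that] PSB[OF that]
    using measurable_sets[OF fst_m that] by (intro emeasure_mono) auto
  have fin: "(\<integral>\<^sup>+s. f q s \<partial>PS) < \<infinity>" for q
  proof -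
    have "(\<integral>\<^sup>+s. f q s \<partial>PS) = (\<integral>\<^sup>+s\<in>space S. f q s \<partial>PS)"
      by (rule nn_integral_cong) (simp add: spPS)
    also have "\<dots> \<le> emeasure PS (space S)" by (rule fle) simp
    also have "\<dots> < \<infinity>" by (simp add: less_top[symmetric])
    finally show ?thesis .
  qed
  have "AE s in PS. f q s \<le> f r s" if "q \<le> r" for q r
  proof (rule AE_le_if_set_nn_integral_le[OF _ _ fin])
    fix B assume "B \<in> sets PS"
    then have B: "B \<in> sets S" by (simp add: sPS)
    show "(\<integral>\<^sup>+s\<in>B. f q s \<partial>PS) \<le> (\<integral>\<^sup>+s\<in>B. f r s \<partial>PS)"
      unfolding f[OF B] using that set_m[OF B]
      by (intro emeasure_mono) (auto simp: of_rat_less_eq intro: order_trans)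
  qed measurable
  then have "AE s in PS. q \<le> r \<longrightarrow> f q s \<le> f r s" for q r by (cases "q \<le> r") auto
  then have mono: "AE s in PS. mono (\<lambda>q. f q s)"
    unfolding mono_def by (simp add: AE_all_countable)
  have "AE s in PS. f q s \<le> 1" for q
  proof (rule AE_le_if_set_nn_integral_le[OF _ _ fin])
    fix B assume B: "B \<in> sets PS"
    then have "(\<integral>\<^sup>+s\<in>B. f q s \<partial>PS) \<le> emeasure PS B" using fle by (simp add: sPS)
    also have "\<dots> = (\<integral>\<^sup>+s\<in>B. 1 \<partial>PS)" using B by simp
    finally show "(\<integral>\<^sup>+s\<in>B. f q s \<partial>PS) \<le> (\<integral>\<^sup>+s\<in>B. 1 \<partial>PS)" .
  qed measurable
  then have le1: "AE s in PS. \<forall>q. f q s \<le> 1" by (simp add: AE_all_countable)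

  \<comment> \<open>\<open>K0 s\<close> is a probability measure for every s; \<open>mono\<close>
    and \<open>le1\<close> enter only when it is identified almost surely as the conditional
    law.\<close>
  define K0 where "K0 s = distr unit_leb borel (quantile (\<lambda>q. f q s))" for s
  have K0: "K0 \<in> S \<rightarrow>\<^sub>M prob_algebra borel"
    unfolding K0_def
  proof (rule measurable_distr_prob_space2)
    show "(\<lambda>s. unit_leb) \<in> S \<rightarrow>\<^sub>M prob_algebra unit_leb"
      by (rule measurable_const) (simp add: space_prob_algebra prob_space_unit_leb)
    show "(\<lambda>(s, t). quantile (\<lambda>q. f q s) t) \<in> borel_measurable (S \<Otimes>\<^sub>M unit_leb)"
      by (rule borel_measurable_quantile) measurable
  qed
  have K0m: "(\<lambda>s. emeasure (K0 s) C) \<in> borel_measurable S" if "C \<in> sets borel" for C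
    using that by (rule measurable_compose[OF measurable_prob_algebraD[OF K0] measurable_emeasure_subprob_algebra])
  have main: "emeasure P {w \<in> space P. fst w \<in> B \<and> \<phi> (snd w) \<in> C} = (\<integral>\<^sup>+s\<in>B. emeasure (K0 s) C \<partial>PS)"
    if B[measurable]: "B \<in> sets S" and C: "C \<in> sets borel" for B C
  proof -
    define E where "E = {w \<in> space P. fst w \<in> B}"
    have E[measurable]: "E \<in> sets P" unfolding E_def by measurable
    \<comment> \<open>For fixed B both sides are finite measures in C, so comparing them on
      half-lines is enough.\<close>
    define N1 where "N1 = distr (density P (indicator E)) borel (\<lambda>w. \<phi> (snd w))"
    define N2 where "N2 = density PS (indicator B) \<bind> K0"
    have N1: "emeasure N1 C = emeasure P {w \<in> space P. fst w \<in> B \<and> \<phi> (snd w) \<in> C}"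
      if [measurable]: "C \<in> sets borel" for C
    proof -
      have "emeasure N1 C = emeasure P (E \<inter> ((\<lambda>w. \<phi> (snd w)) -` C \<inter> space P))"
        unfolding N1_def by (subst emeasure_distr) (simp_all add: emeasure_restricted)
      also have "E \<inter> ((\<lambda>w. \<phi> (snd w)) -` C \<inter> space P) = {w \<in> space P. fst w \<in> B \<and> \<phi> (snd w) \<in> C}"
        by (auto simp: E_def)
      finally show ?thesis .
    qed
    have N2: "emeasure N2 C = (\<integral>\<^sup>+s\<in>B. emeasure (K0 s) C \<partial>PS)" if C: "C \<in> sets borel" for C
    proof -
      have "emeasure N2 C = (\<integral>\<^sup>+s. emeasure (K0 s) C \<partial>density PS (indicator B))"
        unfolding N2_def
      proof (rule emeasure_bind[OF _ _ C])
        show "space (density PS (indicator B)) \<noteq> {}" using PS.not_empty by simp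
        show "K0 \<in> density PS (indicator B) \<rightarrow>\<^sub>M subprob_algebra borel"
          using measurable_prob_algebraD[OF K0] by (simp cong: measurable_cong_sets add: sPS)
      qed
      also have "\<dots> = (\<integral>\<^sup>+s. indicator B s * emeasure (K0 s) C \<partial>PS)"
        using K0m[OF C] B by (intro nn_integral_density) (simp_all cong: measurable_cong_sets add: sPS)
      finally show ?thesis by (simp add: mult.commute)
    qed
    have "N1 = N2"
    proof (rule finite_measure_eqI_lessThan)
      show "sets N1 = sets borel" by (simp add: N1_def)
      show "sets N2 = sets borel" unfolding N2_def
        using PS.not_empty measurable_space[OF K0]
        by (intro sets_bind) (auto simp: spPS space_prob_algebra)
      show "finite_measure N1"
        by (rule finite_measureI) (use sets_eq_imp_space_eq[OF \<open>sets N1 = sets borel\<close>] in \<open>simp add: N1\<close>)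
      fix x :: real
      have PSB': "emeasure P {w \<in> space P. fst w \<in> B} = emeasure PS B"
        unfolding PSB[OF B] by (rule arg_cong[where f = "emeasure P"]) auto
      consider "1 < x" | "x \<le> 0" | "0 < x" "x \<le> 1" by linarith
      then have "emeasure P {w \<in> space P. fst w \<in> B \<and> \<phi> (snd w) \<in> {..<x}} = (\<integral>\<^sup>+s\<in>B. emeasure (K0 s) {..<x} \<partial>PS)"
      proof cases
        case 1
        have "{w \<in> space P. fst w \<in> B \<and> \<phi> (snd w) \<in> {..<x}} = {w \<in> space P. fst w \<in> B}"
          using phi01 1 by (fastforce simp: spP)
        then show ?thesis using 1 by (simp add: K0_def emeasure_distr_quantile_gt_1 PSB' sPS)
      next
        case 2
        have e: "{w \<in> space P. fst w \<in> B \<and> \<phi> (snd w) \<in> {..<x}} = {}"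
          using phi01 2 by (fastforce simp: spP)
        show ?thesis unfolding e using 2 by (simp add: K0_def emeasure_distr_quantile_nonpos)
      next
        case 3
        then obtain s :: "nat \<Rightarrow> rat" where s0: "incseq s"
          "\<forall>y\<ge>0. y < x \<longleftrightarrow> (\<exists>n. y \<le> of_rat (s n))"
          "\<forall>f. mono f \<longrightarrow> (\<forall>q. f q \<le> 1) \<longrightarrow>
            emeasure (distr unit_leb borel (quantile f)) {..<x} = (SUP n. f (s n))"
          by (rule rat_approx_below) blast
        note s = s0(1) s0(2)[rule_format] s0(3)[rule_format]
        let ?D = "\<lambda>n. {w \<in> space P. fst w \<in> B \<and> \<phi> (snd w) \<le> of_rat (s n)}"
        have "{w \<in> space P. fst w \<in> B \<and> \<phi> (snd w) \<in> {..<x}} = (\<Union>n. ?D n)"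
          using s(2) phi01 by (auto simp: spP)
        then have "emeasure P {w \<in> space P. fst w \<in> B \<and> \<phi> (snd w) \<in> {..<x}} = emeasure P (\<Union>n. ?D n)"
          by simp
        also have "\<dots> = (SUP n. emeasure P (?D n))"
        proof (rule SUP_emeasure_incseq[symmetric])
          show "range ?D \<subseteq> sets P" using set_m[OF B] by auto
          show "incseq ?D"
          proof (intro monoI subsetI)
            fix m n w assume "m \<le> n" and w: "w \<in> ?D m"
            then have "real_of_rat (s m) \<le> of_rat (s n)"
              using s(1) by (simp add: incseq_def of_rat_less_eq)
            with w show "w \<in> ?D n" by simp
          qed
        qed
        also have "\<dots> = (SUP n. \<integral>\<^sup>+t\<in>B. f (s n) t \<partial>PS)" by (simp add: f[OF B])
        also have "\<dots> = (\<integral>\<^sup>+t. (SUP n. f (s n) t * indicator B t) \<partial>PS)"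
        proof (rule nn_integral_monotone_convergence_SUP_AE[symmetric])
          show "AE t in PS. f (s n) t * indicator B t \<le> f (s (Suc n)) t * indicator B t" for n
            using mono by eventually_elim
              (use s(1) in \<open>auto intro!: mult_right_mono simp: mono_def incseq_Suc_iff\<close>)
        qed measurable
        also have "\<dots> = (\<integral>\<^sup>+t\<in>B. emeasure (K0 t) {..<x} \<partial>PS)"
        proof (rule nn_integral_cong_AE)
          show "AE t in PS. (SUP n. f (s n) t * indicator B t) = emeasure (K0 t) {..<x} * indicator B t"
            using mono le1
          proof eventually_elim
            case (elim t)
            then have "emeasure (K0 t) {..<x} = (SUP n. f (s n) t)"
              unfolding K0_def by (intro s(3)) auto
            then show ?case by (simp split: split_indicator)
          qed
        qed
        finally show ?thesis .
      qed
      then show "emeasure N1 {..<x} = emeasure N2 {..<x}" by (simp only: N1 N2 lessThan_borel)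
    qed
    then show ?thesis using N1[OF C] N2[OF C] by simp
  qed
  show thesis
  proof (rule that)
    show "(\<lambda>s. distr (K0 s) A \<psi>) \<in> S \<rightarrow>\<^sub>M prob_algebra A"
      using K0 measurable_distr_prob_space[OF psi] by (rule measurable_compose)
    fix B C assume B: "B \<in> sets S" and C: "C \<in> sets A"
    have psiC: "\<psi> -` C \<in> sets borel" using measurable_sets[OF psi C] by simp
    have "emeasure P (B \<times> C) = emeasure P {w \<in> space P. fst w \<in> B \<and> \<phi> (snd w) \<in> \<psi> -` C}"
      using sets.sets_into_space[OF B] sets.sets_into_space[OF C] inv
      by (intro arg_cong[where f = "emeasure P"]) (auto simp: spP)
    also have "\<dots> = (\<integral>\<^sup>+s\<in>B. emeasure (K0 s) (\<psi> -` C) \<partial>PS)" by (rule main[OF B psiC])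
    also have "\<dots> = (\<integral>\<^sup>+s\<in>B. emeasure (distr (K0 s) A \<psi>) C \<partial>PS)"
    proof (rule nn_integral_cong)
      fix s assume "s \<in> space PS"
      then have "sets (K0 s) = sets borel"
        using measurable_space[OF K0] by (simp add: spPS space_prob_algebra)
      then have "emeasure (distr (K0 s) A \<psi>) C = emeasure (K0 s) (\<psi> -` C)"
        using C psi sets_eq_imp_space_eq[of "K0 s" borel]
        by (subst emeasure_distr) (simp_all cong: measurable_cong_sets)
      then show "emeasure (K0 s) (\<psi> -` C) * indicator B s = emeasure (distr (K0 s) A \<psi>) C * indicator B s"
        by simp
    qed
    finally show "emeasure P (B \<times> C) = (\<integral>\<^sup>+s\<in>B. emeasure (distr (K0 s) A \<psi>) C \<partial>distr P S fst)"
      by (simp add: PS_def)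
  qed
qed

section \<open>Exchangeable laws\<close>

text \<open>Padding with \<open>space A\<close> makes the index set an initial segment, so that
  cylinders can be treated by induction on k with every \<open>E i\<close> measurable.\<close>

lemma cylinderE:
  fixes A :: "'a measure"
  assumes "D \<in> prod_algebra (UNIV :: nat set) (\<lambda>_. A)"
  obtains k E where "\<And>i. E i \<in> sets A" "D = {x \<in> space (seq_space A). \<forall>i<k. x i \<in> E i}"
proof -
  from assms obtain J E where J: "finite J" "D = prod_emb UNIV (\<lambda>_. A) J (Pi\<^sub>E J E)"
    "\<And>i. i \<in> J \<Longrightarrow> E i \<in> sets A"
    by (auto elim!: prod_algebraE)
  obtain k where k: "J \<subseteq> {..<k}" using finite_nat_bounded[OF J(1)] by blast
  let ?E = "\<lambda>i. if i \<in> J then E i else space A"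
  have "D = {x \<in> space (seq_space A). \<forall>i\<in>J. x i \<in> E i}"
    unfolding J(2) prod_emb_def by (auto simp: space_PiM PiE_iff)
  also have "\<dots> = {x \<in> space (seq_space A). \<forall>i<k. x i \<in> ?E i}"
    using k by (auto simp: space_PiM PiE_iff split: if_splits)
  finally show thesis using J(3) by (intro that[of ?E k]) auto
qed

text \<open>J and its image have equally many elements, so what each leaves over in their union can
  be matched by a bijection g; outside the union the permutation is the identity.\<close>

lemma ex_finitary_perm_extending:
  assumes J: "finite J" and inj: "inj_on \<tau> J"
  shows "\<exists>\<sigma>\<in>finitary_perms. \<forall>j\<in>J. \<sigma> j = \<tau> j"
proof -
  let ?S = "J \<union> \<tau> ` J"
  have "card (?S - J) = card (?S - \<tau> ` J)"
    using J card_image[OF inj] by (simp add: card_Diff_subset)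
  then obtain g where g: "bij_betw g (?S - J) (?S - \<tau> ` J)"
    using finite_same_card_bij[of "?S - J" "?S - \<tau> ` J"] J by auto
  define \<sigma> where "\<sigma> n = (if n \<in> J then \<tau> n else if n \<in> ?S then g n else n)" for n
  have "bij_betw \<sigma> J (\<tau> ` J)"
    using inj by (subst bij_betw_cong[of J \<sigma> \<tau>]) (auto simp: \<sigma>_def bij_betw_def)
  moreover have "bij_betw \<sigma> (?S - J) (?S - \<tau> ` J)"
    using g by (subst bij_betw_cong[of "?S - J" \<sigma> g]) (auto simp: \<sigma>_def)
  ultimately have "bij_betw \<sigma> (J \<union> (?S - J)) (\<tau> ` J \<union> (?S - \<tau> ` J))"
    by (rule bij_betw_combine) auto
  moreover have "J \<union> (?S - J) = ?S" "\<tau> ` J \<union> (?S - \<tau> ` J) = ?S" by auto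
  ultimately have "bij_betw \<sigma> ?S ?S" by (simp only:)
  then have "\<sigma> permutes ?S" by (rule bij_imp_permutes) (auto simp: \<sigma>_def)
  moreover have "{n. \<sigma> n \<noteq> n} \<subseteq> ?S" by (auto simp: \<sigma>_def)
  then have "finite {n. \<sigma> n \<noteq> n}" by (rule finite_subset) (use J in simp)
  ultimately have "\<sigma> \<in> finitary_perms" by (simp add: finitary_perms_def permutes_bij)
  then show ?thesis by (intro bexI[of _ \<sigma>]) (simp_all add: \<sigma>_def)
qed

text \<open>Conditions on finitely many evaluations over the generator form a pi-system generating
  the sigma-algebra of \<open>prob_algebra N\<close>. Each such event sees only finitely many sets,
  so the substitute X' may be adapted to F; this admits a permutation that works for F
  alone.\<close>

lemma random_measure_law_eqI:
  assumes X: "X \<in> W \<rightarrow>\<^sub>M prob_algebra N" and Y: "Y \<in> W' \<rightarrow>\<^sub>M prob_algebra N"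
    and W: "prob_space W"
    and G: "sets N = sigma_sets \<Omega> G" "Int_stable G" "G \<subseteq> Pow \<Omega>"
    and ex: "\<And>F. finite F \<Longrightarrow> F \<subseteq> G \<Longrightarrow> \<exists>X'\<in>W \<rightarrow>\<^sub>M prob_algebra N.
      distr W (prob_algebra N) X' = distr W' (prob_algebra N) Y \<and>
      (\<forall>D\<in>F. AE w in W. emeasure (X w) D = emeasure (X' w) D)"
  shows "distr W (prob_algebra N) X = distr W' (prob_algebra N) Y"
proof -
  let ?P = "prob_algebra N"
  define H where "H = {{\<nu> \<in> space ?P. \<forall>D\<in>F. emeasure \<nu> D \<in> U D} | F U.
    finite F \<and> F \<subseteq> G \<and> (\<forall>D. U D \<in> sets (borel :: ennreal measure))}"
  have GN: "D \<in> sets N" if "D \<in> G" for D using that G(1) by (auto intro: sigma_sets.Basic)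
  have em: "(\<lambda>\<nu>. emeasure \<nu> D) \<in> borel_measurable ?P" if "D \<in> sets N" for D
    using measurable_compose[OF measurable_prob_algebraD[OF measurable_ident] measurable_emeasure_subprob_algebra[OF that]]
    by (simp add: id_def)
  have Hsets: "h \<in> sets ?P" if "h \<in> H" for h
  proof -
    from that obtain F U where h: "h = {\<nu> \<in> space ?P. \<forall>D\<in>F. emeasure \<nu> D \<in> U D}"
      and F: "finite F" "F \<subseteq> G" "\<And>D. U D \<in> sets (borel :: ennreal measure)"
      unfolding H_def by blast
    show ?thesis unfolding h
    proof (rule sets.sets_Collect_finite_All[OF _ F(1)])
      show "{\<nu> \<in> space ?P. emeasure \<nu> D \<in> U D} \<in> sets ?P" if "D \<in> F" for D
        using measurable_sets[OF em[OF GN] F(3), of D] that F(2)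
        by (simp add: vimage_def Int_def conj_commute subset_iff)
    qed
  qed
  have Hsub: "H \<subseteq> Pow (space ?P)" by (auto simp: H_def)
  have Hgen: "sets ?P = sigma_sets (space ?P) H"
  proof
    let ?S = "sigma (space ?P) H"
    \<comment> \<open>H generates because the identity out of its sigma-algebra is measurable into
      \<open>?P\<close>, and this may be tested by evaluations on G, each of which is a one-element
      family in H.\<close>
    have "(\<lambda>\<nu>. \<nu>) \<in> ?S \<rightarrow>\<^sub>M ?P"
    proof (rule measurable_prob_algebra_generated[OF G])
      fix D assume D: "D \<in> G"
      show "(\<lambda>\<nu>. emeasure \<nu> D) \<in> borel_measurable ?S"
      proof (rule measurableI)
        fix U :: "ennreal set" assume U: "U \<in> sets borel"
        have "(\<lambda>\<nu>. emeasure \<nu> D) -` U \<inter> space ?S = {\<nu> \<in> space ?P. \<forall>D\<in>{D}. emeasure \<nu> D \<in> U}"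
          using Hsub by (auto simp: space_measure_of)
        also have "\<dots> \<in> H" unfolding H_def using D U
          by (intro CollectI exI[of _ "{D}"] exI[of _ "\<lambda>_. U"]) auto
        finally show "(\<lambda>\<nu>. emeasure \<nu> D) -` U \<inter> space ?S \<in> sets ?S" using Hsub by auto
      qed simp
    qed (use Hsub in \<open>auto simp: space_measure_of space_prob_algebra\<close>)
    then have id_m: "(\<lambda>\<nu>. \<nu>) -` h \<inter> space ?S \<in> sets ?S" if "h \<in> sets ?P" for h
      using that by (rule measurable_sets)
    have "h \<in> sets ?S" if "h \<in> sets ?P" for h
    proof -
      have "(\<lambda>\<nu>. \<nu>) -` h \<inter> space ?S = h"
        using sets.sets_into_space[OF that] Hsub by (auto simp: space_measure_of)
      with id_m[OF that] show ?thesis by simp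
    qed
    then have "sets ?P \<subseteq> sets ?S" by blast
    then show "sets ?P \<subseteq> sigma_sets (space ?P) H" using Hsub by simp
    show "sigma_sets (space ?P) H \<subseteq> sets ?P" using Hsets by (intro sets.sigma_sets_subset) auto
  qed
  show ?thesis
  proof (rule measure_eqI_generator_eq[where E = H and \<Omega> = "space ?P" and A = "\<lambda>_. space ?P"])
    show "Int_stable H"
    proof (rule Int_stableI)
      fix a b assume "a \<in> H" "b \<in> H"
      then obtain F1 U1 F2 U2 where
        a: "a = {\<nu> \<in> space ?P. \<forall>D\<in>F1. emeasure \<nu> D \<in> U1 D}"
          "finite F1" "F1 \<subseteq> G" "\<And>D. U1 D \<in> sets (borel :: ennreal measure)" and
        b: "b = {\<nu> \<in> space ?P. \<forall>D\<in>F2. emeasure \<nu> D \<in> U2 D}"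
          "finite F2" "F2 \<subseteq> G" "\<And>D. U2 D \<in> sets (borel :: ennreal measure)"
        unfolding H_def by blast
      \<comment> \<open>A set missing from one of the two families gets the void condition
        \<open>UNIV\<close> there, so the intersection is again a condition over the union of the
        families.\<close>
      let ?U = "\<lambda>D. (if D \<in> F1 then U1 D else UNIV) \<inter> (if D \<in> F2 then U2 D else UNIV)"
      have "a \<inter> b = {\<nu> \<in> space ?P. \<forall>D\<in>F1 \<union> F2. emeasure \<nu> D \<in> ?U D}"
        unfolding a(1) b(1) by auto
      moreover have "?U D \<in> sets borel" for D using a(4) b(4) by auto
      ultimately show "a \<inter> b \<in> H" unfolding H_def using a(2,3) b(2,3)
        by (intro CollectI exI[of _ "F1 \<union> F2"] exI[of _ ?U]) auto
    qed
    show "range (\<lambda>_::nat. space ?P) \<subseteq> H"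
      unfolding H_def by (auto intro!: exI[of _ "{}"] exI[of _ "\<lambda>_. {}"])
    show "emeasure (distr W ?P X) (space ?P) \<noteq> \<infinity>"
      using prob_space.emeasure_space_1[OF prob_space.prob_space_distr[OF W X]] by simp
    fix h assume h: "h \<in> H"
    then obtain F U where hF: "h = {\<nu> \<in> space ?P. \<forall>D\<in>F. emeasure \<nu> D \<in> U D}" "finite F" "F \<subseteq> G"
      unfolding H_def by blast
    from ex[OF hF(2,3)] obtain X' where X': "X' \<in> W \<rightarrow>\<^sub>M ?P"
      "distr W ?P X' = distr W' ?P Y" "\<forall>D\<in>F. AE w in W. emeasure (X w) D = emeasure (X' w) D"
      by blast
    have "AE w in W. \<forall>D\<in>F. emeasure (X w) D = emeasure (X' w) D"
      using X'(3) hF(2) by (simp add: AE_finite_all)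
    then have "AE w in W. X w \<in> h \<longleftrightarrow> X' w \<in> h"
      using AE_space
      by eventually_elim (use measurable_space[OF X] measurable_space[OF X'(1)] in \<open>auto simp: hF(1)\<close>)
    then have "emeasure W (X -` h \<inter> space W) = emeasure W (X' -` h \<inter> space W)"
      using measurable_sets[OF X Hsets[OF h]] measurable_sets[OF X'(1) Hsets[OF h]]
      by (intro emeasure_eq_AE) (auto elim: eventually_mono)
    then show "emeasure (distr W ?P X) h = emeasure (distr W' ?P Y) h"
      unfolding X'(2)[symmetric] by (simp add: emeasure_distr X X'(1) Hsets[OF h])
  next
    show "sets (distr W ?P X) = sigma_sets (space ?P) H" "sets (distr W' ?P Y) = sigma_sets (space ?P) H"
      by (simp_all only: sets_distr Hgen[symmetric])
  qed (use Hsub in auto)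
qed

section \<open>Rearranging the coordinates of a random measure\<close>

definition reindex :: "'a measure \<Rightarrow> (nat \<Rightarrow> nat) \<Rightarrow> (nat \<Rightarrow> 'a) measure \<Rightarrow> (nat \<Rightarrow> 'a) measure" where
  "reindex A \<tau> \<mu> = distr \<mu> (seq_space A) (coord_perm \<tau>)"

lemma measurable_coord_perm[measurable]: "coord_perm \<tau> \<in> seq_space A \<rightarrow>\<^sub>M seq_space A"
  unfolding coord_perm_def by (rule measurable_PiM_single') (auto simp: space_PiM PiE_iff)

lemma measurable_reindex[measurable]:
  "reindex A \<tau> \<in> prob_algebra (seq_space A) \<rightarrow>\<^sub>M prob_algebra (seq_space A)"
  unfolding reindex_def[abs_def] by (rule measurable_distr_prob_space) measurable

lemma coord_perm_coord_perm: "coord_perm \<tau> (coord_perm \<sigma> x) = coord_perm (\<sigma> \<circ> \<tau>) x"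
  by (simp add: coord_perm_def)

text \<open>The order of composition reverses because \<open>coord_perm\<close> acts by
  precomposition.\<close>

lemma reindex_reindex:
  assumes "\<mu> \<in> space (prob_algebra (seq_space A))"
  shows "reindex A \<tau> (reindex A \<sigma> \<mu>) = reindex A (\<sigma> \<circ> \<tau>) \<mu>"
proof -
  have [measurable_cong]: "sets \<mu> = sets (seq_space A)" using assms by (simp add: space_prob_algebra)
  show ?thesis unfolding reindex_def
    by (subst distr_distr) (simp_all add: comp_def coord_perm_coord_perm[unfolded comp_def])
qed

lemma nn_integral_reindex:
  assumes "\<mu> \<in> space (prob_algebra (seq_space A))" and [measurable]: "f \<in> borel_measurable (seq_space A)"
  shows "(\<integral>\<^sup>+x. f x \<partial>reindex A \<tau> \<mu>) = (\<integral>\<^sup>+x. f (coord_perm \<tau> x) \<partial>\<mu>)"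
proof -
  have [measurable_cong]: "sets \<mu> = sets (seq_space A)" using assms by (simp add: space_prob_algebra)
  show ?thesis unfolding reindex_def by (rule nn_integral_distr) measurable
qed

lemma emeasure_reindex:
  assumes "\<mu> \<in> space (prob_algebra (seq_space A))" and D: "D \<in> sets (seq_space A)"
  shows "emeasure (reindex A \<tau> \<mu>) D = emeasure \<mu> {x \<in> space (seq_space A). coord_perm \<tau> x \<in> D}"
proof -
  have s[measurable_cong]: "sets \<mu> = sets (seq_space A)" using assms by (simp add: space_prob_algebra)
  have "emeasure (reindex A \<tau> \<mu>) D = emeasure \<mu> (coord_perm \<tau> -` D \<inter> space \<mu>)"
    unfolding reindex_def using D by (intro emeasure_distr) measurable
  also have "coord_perm \<tau> -` D \<inter> space \<mu> = {x \<in> space (seq_space A). coord_perm \<tau> x \<in> D}"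
    using sets_eq_imp_space_eq[OF s] by auto
  finally show ?thesis .
qed

text \<open>The canonical version of the problem: the random measure is the identity map on the
  space of measures, equipped with its own law Q.\<close>

locale exchangeable_law =
  fixes A :: "'a measure" and Q :: "(nat \<Rightarrow> 'a) measure measure"
  assumes prob_Q: "prob_space Q"
    and sets_Q[measurable_cong]: "sets Q = sets (prob_algebra (seq_space A))"
    and finitary_invariance:
      "\<And>\<sigma>. \<sigma> \<in> finitary_perms \<Longrightarrow> distr Q (prob_algebra (seq_space A)) (reindex A \<sigma>) = Q"
begin

sublocale Q: prob_space Q by (rule prob_Q)

abbreviation S where "S \<equiv> seq_space A"
abbreviation M where "M \<equiv> prob_algebra S"

lemma space_Q: "space Q = space M"
  using sets_Q by (rule sets_eq_imp_space_eq)

lemma space_M_D: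
  assumes "\<mu> \<in> space M"
  shows "sets \<mu> = sets S" "space \<mu> = space S" "prob_space \<mu>"
  using assms sets_eq_imp_space_eq[of \<mu> S] by (auto simp: space_prob_algebra)

text \<open>
  A cylinder set involves finitely many coordinates, and on these an injection agrees with a
  finitary permutation.
\<close>

lemma distr_reindex_inj:
  assumes \<tau>: "inj \<tau>"
  shows "distr Q M (reindex A \<tau>) = Q"
proof -
  have "distr Q M (reindex A \<tau>) = distr Q M (\<lambda>\<mu>. \<mu>)"
  proof (rule random_measure_law_eqI[OF _ _ prob_Q sets_PiM Int_stable_prod_algebra prod_algebra_sets_into_space])
    fix F assume F: "finite F" "F \<subseteq> prod_algebra (UNIV :: nat set) (\<lambda>_. A)"
    have "\<exists>kE. \<forall>D\<in>F. D = {x \<in> space S. \<forall>i<fst (kE D). x i \<in> snd (kE D) i}"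
    proof (rule bchoice, rule ballI)
      fix D assume "D \<in> F"
      with F(2) have "D \<in> prod_algebra (UNIV :: nat set) (\<lambda>_. A)" by blast
      then obtain k E where "D = {x \<in> space S. \<forall>i<k. x i \<in> E i}" by (rule cylinderE)
      then show "\<exists>y. D = {x \<in> space S. \<forall>i<fst y. x i \<in> snd y i}" by (intro exI[of _ "(k, E)"]) simp
    qed
    then obtain kE where kE: "\<forall>D\<in>F. D = {x \<in> space S. \<forall>i<fst (kE D). x i \<in> snd (kE D) i}" by blast
    have "finite (\<Union>D\<in>F. {..<fst (kE D)})" using F(1) by simp
    from ex_finitary_perm_extending[OF this inj_on_subset[OF \<tau> subset_UNIV]]
    obtain \<sigma> where \<sigma>: "\<sigma> \<in> finitary_perms" "\<forall>j\<in>(\<Union>D\<in>F. {..<fst (kE D)}). \<sigma> j = \<tau> j" by blast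
    have "emeasure (reindex A \<tau> \<mu>) D = emeasure (reindex A \<sigma> \<mu>) D" if D: "D \<in> F" and \<mu>: "\<mu> \<in> space M" for D \<mu>
    proof -
      have DS: "D \<in> sets S" using D F(2) by (auto simp: sets_PiM intro: sigma_sets.Basic)
      have \<sigma>\<tau>: "\<And>i. i < fst (kE D) \<Longrightarrow> \<sigma> i = \<tau> i" using \<sigma>(2) D by blast
      have "coord_perm \<tau> x \<in> D \<longleftrightarrow> coord_perm \<sigma> x \<in> D" if x: "x \<in> space S" for x
      proof -
        have "coord_perm \<rho> x \<in> D \<longleftrightarrow> (\<forall>i<fst (kE D). x (\<rho> i) \<in> snd (kE D) i)" for \<rho>
        proof -
          have "coord_perm \<rho> x \<in> {x \<in> space S. \<forall>i<fst (kE D). x i \<in> snd (kE D) i} \<longleftrightarrow>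
              (\<forall>i<fst (kE D). x (\<rho> i) \<in> snd (kE D) i)"
            using measurable_space[OF measurable_coord_perm x, of \<rho>] by (simp add: coord_perm_def)
          with kE[rule_format, OF D] show ?thesis by blast
        qed
        then show ?thesis using \<sigma>\<tau> by simp
      qed
      then show ?thesis unfolding emeasure_reindex[OF \<mu> DS] by (intro arg_cong2[where f = emeasure]) auto
    qed
    then show "\<exists>X'\<in>Q \<rightarrow>\<^sub>M M. distr Q M X' = distr Q M (\<lambda>\<mu>. \<mu>) \<and>
      (\<forall>D\<in>F. AE w in Q. emeasure (reindex A \<tau> w) D = emeasure (X' w) D)"
      using finitary_invariance[OF \<sigma>(1)] distr_id2[OF sets_Q[symmetric]]
      by (intro bexI[of _ "reindex A \<sigma>"] conjI ballI AE_I2) (simp_all add: space_Q)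
  qed measurable
  then show ?thesis using distr_id2[OF sets_Q[symmetric]] by simp
qed

end

lemma AE_eq_if_nn_integral_squares_eq:
  fixes u v :: "'b \<Rightarrow> ennreal"
  assumes P: "prob_space P" and [measurable]: "u \<in> borel_measurable P" "v \<in> borel_measurable P"
    and le: "\<And>x. x \<in> space P \<Longrightarrow> u x \<le> 1" "\<And>x. x \<in> space P \<Longrightarrow> v x \<le> 1"
    and eq: "(\<integral>\<^sup>+x. u x * u x \<partial>P) = (\<integral>\<^sup>+x. u x * v x \<partial>P)"
      "(\<integral>\<^sup>+x. v x * v x \<partial>P) = (\<integral>\<^sup>+x. u x * v x \<partial>P)"
  shows "AE x in P. u x = v x"
proof -
  \<comment> \<open>The hypotheses say that \<open>u - v\<close> has norm zero in \<open>L\<^sup>2\<close>.\<close>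
  interpret prob_space P by fact
  define a b where "a x = enn2real (u x)" and "b x = enn2real (v x)" for x
  have [measurable]: "a \<in> borel_measurable P" "b \<in> borel_measurable P"
    unfolding a_def[abs_def] b_def[abs_def] by measurable
  have ab: "u x = ennreal (a x)" "v x = ennreal (b x)" if "x \<in> space P" for x
    using le_less_trans[OF le(1)[OF that]] le_less_trans[OF le(2)[OF that]] by (auto simp: a_def b_def)
  have ab0: "0 \<le> a x" "0 \<le> b x" for x by (simp_all add: a_def b_def)
  have "(\<integral>\<^sup>+x. u x * v x \<partial>P) \<le> (\<integral>\<^sup>+x. 1 \<partial>P)"
    using le by (intro nn_integral_mono) (auto intro!: mult_le_one)
  also have "\<dots> = 1" by (simp add: emeasure_space_1)
  finally have fin: "(\<integral>\<^sup>+x. u x * v x \<partial>P) \<noteq> \<infinity>" by (auto simp: top_unique)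
  \<comment> \<open>Since subtraction in \<open>ennreal\<close> is truncated, the square is expanded
    additively, as 2uv plus the squared difference equals the sum of the squares; \<open>fin\<close>
    then allows cancelling 2uv.\<close>
  have "(\<integral>\<^sup>+x. u x * v x \<partial>P) + (\<integral>\<^sup>+x. u x * v x \<partial>P) + (\<integral>\<^sup>+x. ennreal ((a x - b x)\<^sup>2) \<partial>P) =
      (\<integral>\<^sup>+x. u x * v x + u x * v x + ennreal ((a x - b x)\<^sup>2) \<partial>P)"
    by (subst nn_integral_add; (subst nn_integral_add)?) auto
  also have "\<dots> = (\<integral>\<^sup>+x. u x * u x + v x * v x \<partial>P)"
  proof (rule nn_integral_cong)
    fix x assume x: "x \<in> space P"
    have "a x * b x + a x * b x + (a x - b x)\<^sup>2 = a x * a x + b x * b x"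
      by (simp add: power2_eq_square algebra_simps)
    moreover have "u x * v x = ennreal (a x * b x)" "u x * u x = ennreal (a x * a x)" "v x * v x = ennreal (b x * b x)"
      using ab0[of x] by (simp_all add: ab[OF x] ennreal_mult)
    ultimately show "u x * v x + u x * v x + ennreal ((a x - b x)\<^sup>2) = u x * u x + v x * v x"
      using ab0[of x] by (metis add_nonneg_nonneg ennreal_plus mult_nonneg_nonneg zero_le_power2)
  qed
  also have "\<dots> = (\<integral>\<^sup>+x. u x * v x \<partial>P) + (\<integral>\<^sup>+x. u x * v x \<partial>P) + 0"
    by (subst nn_integral_add) (auto simp: eq)
  finally have "(\<integral>\<^sup>+x. ennreal ((a x - b x)\<^sup>2) \<partial>P) = 0"
    using fin by (simp only: ennreal_add_left_cancel) simp
  then have "AE x in P. ennreal ((a x - b x)\<^sup>2) = 0"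
    by (subst (asm) nn_integral_0_iff_AE) auto
  then show ?thesis using AE_space by eventually_elim (simp add: ab ennreal_eq_0_iff)
qed

section \<open>The joint law of the random measure and a sequence sampled from it\<close>

context exchangeable_law
begin

text \<open>Retaining \<mu> as the first coordinate makes it part of what is conditioned on.\<close>

definition sampling :: "((nat \<Rightarrow> 'a) measure \<times> (nat \<Rightarrow> 'a)) measure" where
  "sampling = Q \<bind> (\<lambda>\<mu>. distr \<mu> (M \<Otimes>\<^sub>M S) (Pair \<mu>))"

lemma measurable_sampling_kernel: "(\<lambda>\<mu>. distr \<mu> (M \<Otimes>\<^sub>M S) (Pair \<mu>)) \<in> M \<rightarrow>\<^sub>M prob_algebra (M \<Otimes>\<^sub>M S)"
  by (rule measurable_distr_prob_space2[where g = "\<lambda>\<mu>. \<mu>"]) measurable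

lemma Q_in: "Q \<in> space (prob_algebra M)"
  by (simp add: space_prob_algebra sets_Q prob_Q)

lemma sets_sampling[measurable_cong]: "sets sampling = sets (M \<Otimes>\<^sub>M S)"
  unfolding sampling_def by (rule sets_bind'[OF Q_in measurable_sampling_kernel])

lemma space_sampling: "space sampling = space M \<times> space S"
  using sets_eq_imp_space_eq[OF sets_sampling] by (simp add: space_pair_measure)

lemma prob_sampling: "prob_space sampling"
  unfolding sampling_def by (rule prob_space_bind'[OF Q_in measurable_sampling_kernel])

sublocale sampling: prob_space sampling by (rule prob_sampling)

lemma nn_integral_sampling:
  assumes f[measurable]: "f \<in> borel_measurable (M \<Otimes>\<^sub>M S)"
  shows "(\<integral>\<^sup>+w. f w \<partial>sampling) = (\<integral>\<^sup>+\<mu>. \<integral>\<^sup>+x. f (\<mu>, x) \<partial>\<mu> \<partial>Q)"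
proof -
  have k: "(\<lambda>\<mu>. distr \<mu> (M \<Otimes>\<^sub>M S) (Pair \<mu>)) \<in> Q \<rightarrow>\<^sub>M subprob_algebra (M \<Otimes>\<^sub>M S)"
    using measurable_prob_algebraD[OF measurable_sampling_kernel] measurable_cong_sets[OF sets_Q refl] by blast
  have "(\<integral>\<^sup>+w. f w \<partial>sampling) = (\<integral>\<^sup>+\<mu>. \<integral>\<^sup>+w. f w \<partial>distr \<mu> (M \<Otimes>\<^sub>M S) (Pair \<mu>) \<partial>Q)"
    unfolding sampling_def by (rule nn_integral_bind[OF f k])
  also have "\<dots> = (\<integral>\<^sup>+\<mu>. \<integral>\<^sup>+x. f (\<mu>, x) \<partial>\<mu> \<partial>Q)"
  proof (rule nn_integral_cong)
    fix \<mu> assume "\<mu> \<in> space Q"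
    then have \<mu>: "\<mu> \<in> space M" by (simp add: space_Q)
    have [measurable_cong]: "sets \<mu> = sets S" by (rule space_M_D(1)[OF \<mu>])
    have [measurable]: "Pair \<mu> \<in> \<mu> \<rightarrow>\<^sub>M M \<Otimes>\<^sub>M S" using \<mu> by measurable
    show "(\<integral>\<^sup>+w. f w \<partial>distr \<mu> (M \<Otimes>\<^sub>M S) (Pair \<mu>)) = (\<integral>\<^sup>+x. f (\<mu>, x) \<partial>\<mu>)"
      by (rule nn_integral_distr) measurable
  qed
  finally show ?thesis .
qed

text \<open>This is the bridge between \<open>sampling\<close> and Q: an identity under
  \<open>sampling\<close> valid for all events B of \<mu> becomes an identity of inner integrals for
  Q-almost every \<mu>.\<close>

lemma set_nn_integral_Q:
  assumes [measurable]: "B \<in> sets M" and F: "(\<lambda>w. F (fst w) (snd w)) \<in> borel_measurable (M \<Otimes>\<^sub>M S)"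
  shows "(\<integral>\<^sup>+\<mu>\<in>B. (\<integral>\<^sup>+x. F \<mu> x \<partial>\<mu>) \<partial>Q) =
    (\<integral>\<^sup>+w. indicator B (fst w) * F (fst w) (snd w) \<partial>sampling)"
proof -
  have "(\<integral>\<^sup>+w. indicator B (fst w) * F (fst w) (snd w) \<partial>sampling) =
      (\<integral>\<^sup>+\<mu>. \<integral>\<^sup>+x. indicator B \<mu> * F \<mu> x \<partial>\<mu> \<partial>Q)"
    using F by (subst nn_integral_sampling) simp_all
  also have "\<dots> = (\<integral>\<^sup>+\<mu>\<in>B. (\<integral>\<^sup>+x. F \<mu> x \<partial>\<mu>) \<partial>Q)"
    by (rule nn_integral_cong) (simp split: split_indicator)
  finally show ?thesis ..
qed

lemma borel_measurable_nn_integral_M: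
  assumes f: "f \<in> borel_measurable (M \<Otimes>\<^sub>M S)"
  shows "(\<lambda>\<mu>. \<integral>\<^sup>+x. f (\<mu>, x) \<partial>\<mu>) \<in> borel_measurable M"
proof (rule nn_integral_measurable_subprob_algebra2[where L = "\<lambda>\<mu>. \<mu>"])
  show "(\<lambda>\<mu>. \<mu>) \<in> M \<rightarrow>\<^sub>M subprob_algebra S"
    using measurable_prob_algebraD[OF measurable_ident] by (simp add: id_def)
qed (use f in simp)

lemma nn_integral_Q_reindex:
  assumes \<tau>: "inj \<tau>" and f: "f \<in> borel_measurable M"
  shows "(\<integral>\<^sup>+\<mu>. f (reindex A \<tau> \<mu>) \<partial>Q) = (\<integral>\<^sup>+\<mu>. f \<mu> \<partial>Q)"
proof -
  have "(\<integral>\<^sup>+\<mu>. f \<mu> \<partial>Q) = (\<integral>\<^sup>+\<mu>. f \<mu> \<partial>distr Q M (reindex A \<tau>))"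
    by (simp only: distr_reindex_inj[OF \<tau>])
  also have "\<dots> = (\<integral>\<^sup>+\<mu>. f (reindex A \<tau> \<mu>) \<partial>Q)"
    using f by (intro nn_integral_distr) measurable
  finally show ?thesis ..
qed

lemma measurable_reindex_pair:
  "(\<lambda>w. (reindex A \<tau> (fst w), coord_perm \<rho> (snd w))) \<in> M \<Otimes>\<^sub>M S \<rightarrow>\<^sub>M M \<Otimes>\<^sub>M S"
  by (intro measurable_Pair measurable_compose[OF measurable_fst measurable_reindex]
      measurable_compose[OF measurable_snd measurable_coord_perm])

text \<open>Measure and sample are moved together: if x is drawn from \<mu>, its rearrangement is a
  draw from \<open>reindex A \<tau> \<mu>\<close>, and that measure again has law Q.\<close>

lemma nn_integral_sampling_reindex:
  assumes \<tau>: "inj \<tau>" and f[measurable]: "f \<in> borel_measurable (M \<Otimes>\<^sub>M S)"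
  shows "(\<integral>\<^sup>+w. f (reindex A \<tau> (fst w), coord_perm \<tau> (snd w)) \<partial>sampling) = (\<integral>\<^sup>+w. f w \<partial>sampling)"
proof -
  have "(\<integral>\<^sup>+w. f (reindex A \<tau> (fst w), coord_perm \<tau> (snd w)) \<partial>sampling) =
      (\<integral>\<^sup>+\<mu>. \<integral>\<^sup>+x. f (reindex A \<tau> \<mu>, coord_perm \<tau> x) \<partial>\<mu> \<partial>Q)"
    using nn_integral_sampling[OF measurable_compose[OF measurable_reindex_pair f]] by simp
  also have "\<dots> = (\<integral>\<^sup>+\<mu>. \<integral>\<^sup>+x. f (reindex A \<tau> \<mu>, x) \<partial>reindex A \<tau> \<mu> \<partial>Q)"
  proof (rule nn_integral_cong)
    fix \<mu> assume "\<mu> \<in> space Q"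
    then have \<mu>: "\<mu> \<in> space M" by (simp add: space_Q)
    show "(\<integral>\<^sup>+x. f (reindex A \<tau> \<mu>, coord_perm \<tau> x) \<partial>\<mu>) = (\<integral>\<^sup>+x. f (reindex A \<tau> \<mu>, x) \<partial>reindex A \<tau> \<mu>)"
      using measurable_space[OF measurable_reindex \<mu>, of \<tau>]
      by (intro nn_integral_reindex[OF \<mu>, symmetric] measurable_compose[OF measurable_Pair1' f])
  qed
  also have "\<dots> = (\<integral>\<^sup>+\<mu>. \<integral>\<^sup>+x. f (\<mu>, x) \<partial>\<mu> \<partial>Q)"
    by (rule nn_integral_Q_reindex[OF \<tau> borel_measurable_nn_integral_M[OF f]])
  finally show ?thesis by (simp add: nn_integral_sampling)
qed

end

text \<open>
  \<open>K\<close> is a version of the conditional distribution of coordinate \<open>0\<close> given \<open>\<mu>\<close> and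
  all other coordinates.
\<close>

locale exchangeable_law_kernel = exchangeable_law +
  fixes K
  assumes measurable_K[measurable]: "K \<in> M \<Otimes>\<^sub>M S \<rightarrow>\<^sub>M prob_algebra A"
    and K_disintegrates: "\<And>B D C. B \<in> sets M \<Longrightarrow> D \<in> sets S \<Longrightarrow> C \<in> sets A \<Longrightarrow>
      (\<integral>\<^sup>+w. indicator B (fst w) * indicator D (coord_perm Suc (snd w)) * indicator C (snd w 0) \<partial>sampling) =
      (\<integral>\<^sup>+w. indicator B (fst w) * indicator D (coord_perm Suc (snd w)) *
         emeasure (K (fst w, coord_perm Suc (snd w))) C \<partial>sampling)"

lemma (in exchangeable_law) kernel_exists:
  assumes R: "measurable_retract A (restrict_space borel {0..1::real})"
  obtains K where "exchangeable_law_kernel A Q K"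
proof -
  define g where "g w = ((fst w, coord_perm Suc (snd w)), snd w (0::nat))"
    for w :: "(nat \<Rightarrow> 'a) measure \<times> (nat \<Rightarrow> 'a)"
  have g[measurable]: "g \<in> M \<Otimes>\<^sub>M S \<rightarrow>\<^sub>M (M \<Otimes>\<^sub>M S) \<Otimes>\<^sub>M A" unfolding g_def by measurable
  have g': "g \<in> sampling \<rightarrow>\<^sub>M (M \<Otimes>\<^sub>M S) \<Otimes>\<^sub>M A" by measurable
  let ?P = "distr sampling ((M \<Otimes>\<^sub>M S) \<Otimes>\<^sub>M A) g"
  have "prob_space ?P" by (rule sampling.prob_space_distr[OF g'])
  then obtain K where K[measurable]: "K \<in> M \<Otimes>\<^sub>M S \<rightarrow>\<^sub>M prob_algebra A" and dis:
    "\<And>B C. B \<in> sets (M \<Otimes>\<^sub>M S) \<Longrightarrow> C \<in> sets A \<Longrightarrow>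
      emeasure ?P (B \<times> C) = (\<integral>\<^sup>+s\<in>B. emeasure (K s) C \<partial>distr ?P (M \<Otimes>\<^sub>M S) fst)"
    by (rule disintegration_exists[OF R, of ?P "M \<Otimes>\<^sub>M S"]) auto
  have Km[measurable]: "(\<lambda>w. emeasure (K w) C) \<in> borel_measurable (M \<Otimes>\<^sub>M S)" if "C \<in> sets A" for C
    using that by (rule measurable_compose[OF measurable_prob_algebraD[OF K] measurable_emeasure_subprob_algebra])
  have "exchangeable_law_kernel A Q K"
  proof (unfold_locales, rule K)
    fix B D C assume [measurable]: "B \<in> sets M" "D \<in> sets S" and C[measurable]: "C \<in> sets A"
    have BD: "B \<times> D \<in> sets (M \<Otimes>\<^sub>M S)" by measurable
    have "(\<integral>\<^sup>+w. indicator B (fst w) * indicator D (coord_perm Suc (snd w)) * indicator C (snd w 0) \<partial>sampling)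
        = (\<integral>\<^sup>+w. indicator ((B \<times> D) \<times> C) (g w) \<partial>sampling)"
      by (rule nn_integral_cong) (auto simp: g_def split: split_indicator)
    also have "\<dots> = (\<integral>\<^sup>+w. indicator ((B \<times> D) \<times> C) w \<partial>?P)"
      using g' by (intro nn_integral_distr[symmetric]) measurable
    also have "\<dots> = emeasure ?P ((B \<times> D) \<times> C)" by (rule nn_integral_indicator) simp
    also have "\<dots> = (\<integral>\<^sup>+s\<in>B \<times> D. emeasure (K s) C \<partial>distr ?P (M \<Otimes>\<^sub>M S) fst)"
      by (rule dis[OF BD C])
    also have "\<dots> = (\<integral>\<^sup>+w. emeasure (K (fst w)) C * indicator (B \<times> D) (fst w) \<partial>?P)"
      by (rule nn_integral_distr) measurable
    also have "\<dots> = (\<integral>\<^sup>+w. emeasure (K (fst (g w))) C * indicator (B \<times> D) (fst (g w)) \<partial>sampling)"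
      using g' by (intro nn_integral_distr) measurable
    also have "\<dots> = (\<integral>\<^sup>+w. indicator B (fst w) * indicator D (coord_perm Suc (snd w)) *
         emeasure (K (fst w, coord_perm Suc (snd w))) C \<partial>sampling)"
      by (rule nn_integral_cong) (auto simp: g_def split: split_indicator)
    finally show "(\<integral>\<^sup>+w. indicator B (fst w) * indicator D (coord_perm Suc (snd w)) * indicator C (snd w 0) \<partial>sampling) =
      (\<integral>\<^sup>+w. indicator B (fst w) * indicator D (coord_perm Suc (snd w)) *
         emeasure (K (fst w, coord_perm Suc (snd w))) C \<partial>sampling)" .
  qed
  then show thesis by (rule that)
qed

section \<open>Conditional independence\<close>

context exchangeable_law_kernel
begin

lemma measurable_emeasure_K[measurable (raw)]:
  assumes "f \<in> N \<rightarrow>\<^sub>M M \<Otimes>\<^sub>M S" "C \<in> sets A"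
  shows "(\<lambda>w. emeasure (K (f w)) C) \<in> borel_measurable N"
  by (rule measurable_compose[OF assms(1) measurable_compose[OF measurable_prob_algebraD[OF measurable_K]
        measurable_emeasure_subprob_algebra[OF assms(2)]]])

lemma emeasure_K_le_1:
  assumes "w \<in> space (M \<Otimes>\<^sub>M S)"
  shows "emeasure (K w) C \<le> 1"
  using measurable_space[OF measurable_K assms]
  by (simp add: space_prob_algebra prob_space.emeasure_le_1)

text \<open>The fibrewise form is what can be transported: it may be evaluated at a rearranged
  measure while events of the original \<mu> are still used as tests.\<close>

lemma AE_disintegration:
  assumes D[measurable]: "D \<in> sets S" and C[measurable]: "C \<in> sets A"
  shows "AE \<mu> in Q. (\<integral>\<^sup>+x. indicator D (coord_perm Suc x) * indicator C (x 0) \<partial>\<mu>) =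
    (\<integral>\<^sup>+x. indicator D (coord_perm Suc x) * emeasure (K (\<mu>, coord_perm Suc x)) C \<partial>\<mu>)"
proof (rule AE_eq_if_set_nn_integral_eq)
  have f: "(\<lambda>w. indicator D (coord_perm Suc (snd w)) * indicator C (snd w 0) :: ennreal)
      \<in> borel_measurable (M \<Otimes>\<^sub>M S)" by measurable
  have g: "(\<lambda>w. indicator D (coord_perm Suc (snd w)) * emeasure (K (fst w, coord_perm Suc (snd w))) C)
      \<in> borel_measurable (M \<Otimes>\<^sub>M S)" by measurable
  show f': "(\<lambda>\<mu>. \<integral>\<^sup>+x. indicator D (coord_perm Suc x) * indicator C (x 0) \<partial>\<mu>) \<in> borel_measurable Q"
    using borel_measurable_nn_integral_M[OF f] by (simp cong: measurable_cong_sets add: sets_Q)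
  show g': "(\<lambda>\<mu>. \<integral>\<^sup>+x. indicator D (coord_perm Suc x) * emeasure (K (\<mu>, coord_perm Suc x)) C \<partial>\<mu>)
      \<in> borel_measurable Q"
    using borel_measurable_nn_integral_M[OF g] by (simp cong: measurable_cong_sets add: sets_Q)
  have "(\<integral>\<^sup>+\<mu>. \<integral>\<^sup>+x. indicator D (coord_perm Suc x) * indicator C (x 0) \<partial>\<mu> \<partial>Q) \<le> (\<integral>\<^sup>+\<mu>. 1 \<partial>Q)"
  proof (rule nn_integral_mono)
    fix \<mu> assume "\<mu> \<in> space Q"
    then interpret \<mu>: prob_space \<mu> by (intro space_M_D(3)) (simp add: space_Q)
    have "(\<integral>\<^sup>+x. indicator D (coord_perm Suc x) * indicator C (x 0) \<partial>\<mu>) \<le> (\<integral>\<^sup>+x. 1 \<partial>\<mu>)"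
      by (rule nn_integral_mono) (auto split: split_indicator)
    then show "(\<integral>\<^sup>+x. indicator D (coord_perm Suc x) * indicator C (x 0) \<partial>\<mu>) \<le> 1"
      by (simp add: \<mu>.emeasure_space_1)
  qed
  also have "\<dots> < \<infinity>" by (simp add: Q.emeasure_space_1)
  finally show "(\<integral>\<^sup>+\<mu>. \<integral>\<^sup>+x. indicator D (coord_perm Suc x) * indicator C (x 0) \<partial>\<mu> \<partial>Q) < \<infinity>" .
  fix B assume "B \<in> sets Q"
  then have B[measurable]: "B \<in> sets M" by (simp add: sets_Q)
  show "(\<integral>\<^sup>+\<mu>\<in>B. (\<integral>\<^sup>+x. indicator D (coord_perm Suc x) * indicator C (x 0) \<partial>\<mu>) \<partial>Q) =
      (\<integral>\<^sup>+\<mu>\<in>B. (\<integral>\<^sup>+x. indicator D (coord_perm Suc x) * emeasure (K (\<mu>, coord_perm Suc x)) C \<partial>\<mu>) \<partial>Q)"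
    unfolding set_nn_integral_Q[OF B f] set_nn_integral_Q[OF B g] using K_disintegrates[OF B D C] by (simp add: mult.assoc)
qed

text \<open>The conditional probability that coordinate \<open>\<theta> 0\<close> lies in C, given
  \<mu> and the coordinates \<open>\<theta> 1\<close>, \<open>\<theta> 2\<close> and so on, whose
  values are passed as y. The kernel is the same for every \<theta>; only \<mu> is
  rearranged.\<close>

abbreviation cond_prob :: "(nat \<Rightarrow> nat) \<Rightarrow> 'a set \<Rightarrow> (nat \<Rightarrow> 'a) measure \<Rightarrow> (nat \<Rightarrow> 'a) \<Rightarrow> ennreal" where
  "cond_prob \<theta> C \<mu> y \<equiv> emeasure (K (reindex A \<theta> \<mu>, y)) C"

text \<open>As \<open>reindex A \<theta>\<close> preserves Q, the fibrewise identity holds at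
  \<open>reindex A \<theta> \<mu>\<close> for almost every \<mu>. Multiplying by an event B of \<mu>
  afterwards shows that the kernel, which sees only the rearranged measure, is correct even when all
  of \<mu> is given.\<close>

lemma nn_integral_cond_prob_rectangle:
  assumes \<theta>: "inj \<theta>" and B[measurable]: "B \<in> sets M" and D[measurable]: "D \<in> sets S"
    and C[measurable]: "C \<in> sets A"
  shows "(\<integral>\<^sup>+w. indicator B (fst w) * (indicator D (coord_perm (\<theta> \<circ> Suc) (snd w)) *
      indicator C (snd w (\<theta> 0))) \<partial>sampling) =
    (\<integral>\<^sup>+w. indicator B (fst w) * (indicator D (coord_perm (\<theta> \<circ> Suc) (snd w)) *
      cond_prob \<theta> C (fst w) (coord_perm (\<theta> \<circ> Suc) (snd w))) \<partial>sampling)"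
proof -
  have f: "(\<lambda>w. indicator B (fst w) * (indicator D (coord_perm (\<theta> \<circ> Suc) (snd w)) *
      indicator C (snd w (\<theta> 0))) :: ennreal) \<in> borel_measurable (M \<Otimes>\<^sub>M S)"
    by measurable
  have [measurable]: "(\<lambda>w. (reindex A \<theta> (fst w), coord_perm (\<theta> \<circ> Suc) (snd w))) \<in> M \<Otimes>\<^sub>M S \<rightarrow>\<^sub>M M \<Otimes>\<^sub>M S"
    by (rule measurable_reindex_pair)
  have g: "(\<lambda>w. indicator B (fst w) * (indicator D (coord_perm (\<theta> \<circ> Suc) (snd w)) *
      cond_prob \<theta> C (fst w) (coord_perm (\<theta> \<circ> Suc) (snd w)))) \<in> borel_measurable (M \<Otimes>\<^sub>M S)"
    by measurable
  have "AE \<rho> in distr Q M (reindex A \<theta>). (\<integral>\<^sup>+x. indicator D (coord_perm Suc x) * indicator C (x 0) \<partial>\<rho>) =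
    (\<integral>\<^sup>+x. indicator D (coord_perm Suc x) * emeasure (K (\<rho>, coord_perm Suc x)) C \<partial>\<rho>)"
    unfolding distr_reindex_inj[OF \<theta>] by (rule AE_disintegration[OF D C])
  moreover have "reindex A \<theta> \<in> Q \<rightarrow>\<^sub>M M" by measurable
  ultimately have ae: "AE \<mu> in Q. (\<integral>\<^sup>+x. indicator D (coord_perm Suc x) * indicator C (x 0) \<partial>reindex A \<theta> \<mu>) =
    (\<integral>\<^sup>+x. indicator D (coord_perm Suc x) * emeasure (K (reindex A \<theta> \<mu>, coord_perm Suc x)) C \<partial>reindex A \<theta> \<mu>)"
    by (rule AE_distrD[rotated])
  have "AE \<mu> in Q. (\<integral>\<^sup>+x. indicator B \<mu> * (indicator D (coord_perm (\<theta> \<circ> Suc) x) * indicator C (x (\<theta> 0))) \<partial>\<mu>) =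
    (\<integral>\<^sup>+x. indicator B \<mu> * (indicator D (coord_perm (\<theta> \<circ> Suc) x) *
      cond_prob \<theta> C \<mu> (coord_perm (\<theta> \<circ> Suc) x)) \<partial>\<mu>)"
    using ae AE_space
  proof eventually_elim
    case (elim \<mu>)
    then have \<mu>: "\<mu> \<in> space M" by (simp add: space_Q)
    then have \<mu>': "reindex A \<theta> \<mu> \<in> space M" by (rule measurable_space[OF measurable_reindex])
    have [measurable]: "(\<lambda>x. (reindex A \<theta> \<mu>, coord_perm Suc x)) \<in> S \<rightarrow>\<^sub>M M \<Otimes>\<^sub>M S"
      using \<mu>' by measurable
    have "(\<integral>\<^sup>+x. indicator D (coord_perm Suc (coord_perm \<theta> x)) * indicator C (coord_perm \<theta> x 0) \<partial>\<mu>) =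
        (\<integral>\<^sup>+x. indicator D (coord_perm Suc (coord_perm \<theta> x)) *
          emeasure (K (reindex A \<theta> \<mu>, coord_perm Suc (coord_perm \<theta> x))) C \<partial>\<mu>)"
      using elim(1) by (subst (asm) (1 2) nn_integral_reindex[OF \<mu>]) measurable
    then have *: "(\<integral>\<^sup>+x. indicator D (coord_perm (\<theta> \<circ> Suc) x) * indicator C (x (\<theta> 0)) \<partial>\<mu>) =
        (\<integral>\<^sup>+x. indicator D (coord_perm (\<theta> \<circ> Suc) x) * cond_prob \<theta> C \<mu> (coord_perm (\<theta> \<circ> Suc) x) \<partial>\<mu>)"
      unfolding coord_perm_coord_perm by (simp add: coord_perm_def)
    show ?case by (cases "\<mu> \<in> B") (simp_all add: *)
  qed
  then show ?thesis
    unfolding nn_integral_sampling[OF f] nn_integral_sampling[OF g] fst_conv snd_conv by (rule nn_integral_cong_AE)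
qed

text \<open>Rectangles determine finite measures: weighting \<open>sampling\<close> by the indicator
  or by the conditional probability and projecting to the conditioning data gives the same image
  measure, hence the same integral of H.\<close>

lemma nn_integral_cond_prob:
  assumes \<theta>: "inj \<theta>" and H[measurable]: "H \<in> borel_measurable (M \<Otimes>\<^sub>M S)" and C[measurable]: "C \<in> sets A"
  shows "(\<integral>\<^sup>+w. H (fst w, coord_perm (\<theta> \<circ> Suc) (snd w)) * indicator C (snd w (\<theta> 0)) \<partial>sampling) =
    (\<integral>\<^sup>+w. H (fst w, coord_perm (\<theta> \<circ> Suc) (snd w)) *
      cond_prob \<theta> C (fst w) (coord_perm (\<theta> \<circ> Suc) (snd w)) \<partial>sampling)"
proof -
  define p where "p w = (fst w, coord_perm (\<theta> \<circ> Suc) (snd w))" for w :: "(nat \<Rightarrow> 'a) measure \<times> (nat \<Rightarrow> 'a)"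
  define u where "u w = (indicator C (snd w (\<theta> 0)) :: ennreal)" for w :: "(nat \<Rightarrow> 'a) measure \<times> (nat \<Rightarrow> 'a)"
  define v where "v w = cond_prob \<theta> C (fst w) (coord_perm (\<theta> \<circ> Suc) (snd w))" for w
  have p[measurable]: "p \<in> sampling \<rightarrow>\<^sub>M M \<Otimes>\<^sub>M S" unfolding p_def by measurable
  have u[measurable]: "u \<in> borel_measurable sampling" unfolding u_def by measurable
  have [measurable]: "(\<lambda>w. (reindex A \<theta> (fst w), coord_perm (\<theta> \<circ> Suc) (snd w))) \<in> M \<Otimes>\<^sub>M S \<rightarrow>\<^sub>M M \<Otimes>\<^sub>M S"
    by (rule measurable_reindex_pair)
  have v[measurable]: "v \<in> borel_measurable sampling" unfolding v_def by measurable
  define N where "N f = distr (density sampling f) (M \<Otimes>\<^sub>M S) p" for f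
  have N: "(\<integral>\<^sup>+w. H (p w) * f w \<partial>sampling) = (\<integral>\<^sup>+z. H z \<partial>N f)"
    if [measurable]: "f \<in> borel_measurable sampling" "H \<in> borel_measurable (M \<Otimes>\<^sub>M S)" for f H
  proof -
    have "(\<integral>\<^sup>+z. H z \<partial>N f) = (\<integral>\<^sup>+w. H (p w) \<partial>density sampling f)"
      unfolding N_def by (rule nn_integral_distr) measurable
    also have "\<dots> = (\<integral>\<^sup>+w. f w * H (p w) \<partial>sampling)"
      by (rule nn_integral_density) measurable
    finally show ?thesis by (simp add: mult.commute)
  qed
  have "N u = N v"
  proof (rule measure_eqI_generator_eq[where E = "{a \<times> b |a b. a \<in> sets M \<and> b \<in> sets S}"
        and \<Omega> = "space M \<times> space S" and A = "\<lambda>_. space M \<times> space S"])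
    show "Int_stable {a \<times> b |a b. a \<in> sets M \<and> b \<in> sets S}"
      by (rule Int_stable_pair_measure_generator)
    show "{a \<times> b |a b. a \<in> sets M \<and> b \<in> sets S} \<subseteq> Pow (space M \<times> space S)"
      using sets.sets_into_space[of _ M] sets.sets_into_space[of _ S] by blast
    show "sets (N u) = sigma_sets (space M \<times> space S) {a \<times> b |a b. a \<in> sets M \<and> b \<in> sets S}"
      "sets (N v) = sigma_sets (space M \<times> space S) {a \<times> b |a b. a \<in> sets M \<and> b \<in> sets S}"
      by (simp_all only: N_def sets_distr sets_pair_measure)
    have top: "space M \<times> space S \<in> sets (M \<Otimes>\<^sub>M S)" by simp
    have "emeasure (N u) (space M \<times> space S) = (\<integral>\<^sup>+z. indicator (space M \<times> space S) z \<partial>N u)"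
      by (rule nn_integral_indicator[symmetric]) (simp add: N_def)
    also have "\<dots> = (\<integral>\<^sup>+w. indicator (space M \<times> space S) (p w) * u w \<partial>sampling)"
      by (rule N[symmetric]) simp_all
    also have "\<dots> \<le> (\<integral>\<^sup>+w. 1 \<partial>sampling)"
      by (rule nn_integral_mono) (simp add: u_def split: split_indicator)
    also have "\<dots> < \<infinity>" by (simp add: sampling.emeasure_space_1)
    finally show "emeasure (N u) (space M \<times> space S) \<noteq> \<infinity>" by simp
  next
    fix X assume "X \<in> {a \<times> b |a b. a \<in> sets M \<and> b \<in> sets S}"
    then obtain B D where X: "X = B \<times> D" and B[measurable]: "B \<in> sets M" and D[measurable]: "D \<in> sets S" by blast
    have em: "emeasure (N f) X = (\<integral>\<^sup>+w. indicator B (fst w) * (indicator D (coord_perm (\<theta> \<circ> Suc) (snd w)) * f w) \<partial>sampling)"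
      if f: "f \<in> borel_measurable sampling" for f
    proof -
      have "emeasure (N f) X = (\<integral>\<^sup>+z. indicator X z \<partial>N f)"
        by (rule nn_integral_indicator[symmetric]) (simp add: N_def X)
      also have "\<dots> = (\<integral>\<^sup>+w. indicator X (p w) * f w \<partial>sampling)"
        by (rule N[OF f, symmetric]) (simp add: X)
      finally show ?thesis
        by (simp add: X p_def indicator_times mult.assoc)
    qed
    show "emeasure (N u) X = emeasure (N v) X"
      unfolding em[OF u] em[OF v] unfolding u_def v_def
      by (rule nn_integral_cond_prob_rectangle[OF \<theta> B D C])
  qed auto
  then show ?thesis using N[OF u H] N[OF v H] by (simp add: p_def u_def v_def)
qed

text \<open>
  By exchangeability the two conditional probabilities have the same second moment, although
  \<open>\<theta>\<close> conditions on more coordinates than \<open>\<tau>\<close>. Orthogonality of conditional expectations then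
  forces them to agree.
\<close>

lemma AE_cond_prob_eq:
  assumes \<theta>: "inj \<theta>" and \<tau>: "inj \<tau>" and 0: "\<theta> 0 = \<tau> 0"
    and \<iota>: "\<And>n. \<tau> (Suc n) = \<theta> (Suc (\<iota> n))" and C[measurable]: "C \<in> sets A"
  shows "AE w in sampling. cond_prob \<tau> C (fst w) (coord_perm (\<tau> \<circ> Suc) (snd w)) =
    cond_prob \<theta> C (fst w) (coord_perm (\<theta> \<circ> Suc) (snd w))"
proof (rule AE_eq_if_nn_integral_squares_eq[OF prob_sampling])
  have [measurable]: "(\<lambda>w. (reindex A \<sigma> (fst w), coord_perm \<rho> (snd w))) \<in> M \<Otimes>\<^sub>M S \<rightarrow>\<^sub>M M \<Otimes>\<^sub>M S" for \<sigma> \<rho>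
    by (rule measurable_reindex_pair)
  let ?c = "\<lambda>\<sigma> w. cond_prob \<sigma> C (fst w) (coord_perm (\<sigma> \<circ> Suc) (snd w))"
  show "?c \<tau> \<in> borel_measurable sampling" "?c \<theta> \<in> borel_measurable sampling" by measurable
  have le: "?c \<sigma> w \<le> 1" if "w \<in> space sampling" for \<sigma> w
    using measurable_space[OF measurable_reindex_pair, of w \<sigma> "\<sigma> \<circ> Suc"] that
    by (intro emeasure_K_le_1) (simp add: space_sampling space_pair_measure)
  show "?c \<tau> w \<le> 1" "?c \<theta> w \<le> 1" if "w \<in> space sampling" for w by (rule le[OF that])+
  have sq: "(\<integral>\<^sup>+w. ?c \<sigma> w * ?c \<sigma> w \<partial>sampling) =
      (\<integral>\<^sup>+w. emeasure (K (fst w, coord_perm Suc (snd w))) C * emeasure (K (fst w, coord_perm Suc (snd w))) C \<partial>sampling)"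
    if "inj \<sigma>" for \<sigma>
  proof -
    have "(\<lambda>w. emeasure (K (fst w, coord_perm Suc (snd w))) C * emeasure (K (fst w, coord_perm Suc (snd w))) C)
        \<in> borel_measurable (M \<Otimes>\<^sub>M S)" by measurable
    from nn_integral_sampling_reindex[OF that this] show ?thesis by (simp add: coord_perm_coord_perm)
  qed
  \<comment> \<open>Through \<iota> the data conditioned on by \<tau> are a function of those for
    \<theta>, so \<open>?c \<tau>\<close> qualifies as a test function H for \<theta>.\<close>
  have \<tau>\<theta>: "coord_perm (\<tau> \<circ> Suc) x = coord_perm \<iota> (coord_perm (\<theta> \<circ> Suc) x)" for x :: "nat \<Rightarrow> 'a"
    unfolding coord_perm_coord_perm by (simp add: comp_def \<iota>)
  have "(\<integral>\<^sup>+w. ?c \<tau> w * ?c \<tau> w \<partial>sampling) = (\<integral>\<^sup>+w. ?c \<tau> w * indicator C (snd w (\<tau> 0)) \<partial>sampling)"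
  proof -
    have "(\<lambda>w. cond_prob \<tau> C (fst w) (snd w)) \<in> borel_measurable (M \<Otimes>\<^sub>M S)" by measurable
    from nn_integral_cond_prob[OF \<tau> this C] show ?thesis by simp
  qed
  also have "\<dots> = (\<integral>\<^sup>+w. ?c \<tau> w * ?c \<theta> w \<partial>sampling)"
  proof -
    have "(\<lambda>w. cond_prob \<tau> C (fst w) (coord_perm \<iota> (snd w))) \<in> borel_measurable (M \<Otimes>\<^sub>M S)" by measurable
    from nn_integral_cond_prob[OF \<theta> this C] show ?thesis by (simp add: 0 \<tau>\<theta>)
  qed
  finally show 1: "(\<integral>\<^sup>+w. ?c \<tau> w * ?c \<tau> w \<partial>sampling) = (\<integral>\<^sup>+w. ?c \<tau> w * ?c \<theta> w \<partial>sampling)" .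
  show "(\<integral>\<^sup>+w. ?c \<theta> w * ?c \<theta> w \<partial>sampling) = (\<integral>\<^sup>+w. ?c \<tau> w * ?c \<theta> w \<partial>sampling)"
    unfolding 1[symmetric] sq[OF \<tau>] sq[OF \<theta>] ..
qed

section \<open>The odd coordinates given the even reservoir\<close>

abbreviation even_coords :: "nat \<Rightarrow> nat" where "even_coords n \<equiv> 2 * n"
abbreviation odd_coords :: "nat \<Rightarrow> nat" where "odd_coords n \<equiv> 2 * n + 1"

definition odd_then_evens :: "nat \<Rightarrow> nat \<Rightarrow> nat" where
  "odd_then_evens i n = (case n of 0 \<Rightarrow> 2 * i + 1 | Suc m \<Rightarrow> 2 * m)"

lemma odd_then_evens_simps[simp]:
  "odd_then_evens i 0 = 2 * i + 1" "odd_then_evens i (Suc m) = 2 * m"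
  by (simp_all add: odd_then_evens_def)

lemma odd_then_evens_Suc: "odd_then_evens i \<circ> Suc = even_coords"
  by auto

lemma inj_odd_then_evens: "inj (odd_then_evens i)"
  by (rule injI) (auto simp: odd_then_evens_def split: nat.splits; presburger)

text \<open>Induction on k with H arbitrary. The indicator of the last odd coordinate is replaced by
  its conditional probability given the reservoir and the earlier odd coordinates, which by
  \<open>AE_cond_prob_eq\<close> depends on the reservoir alone; that factor is then absorbed into
  H.\<close>

lemma conditional_independence:
  assumes H: "H \<in> borel_measurable (M \<Otimes>\<^sub>M S)" and C: "\<And>i. C i \<in> sets A"
  shows "(\<integral>\<^sup>+w. H (fst w, coord_perm even_coords (snd w)) * (\<Prod>i<k. indicator (C i) (snd w (2 * i + 1))) \<partial>sampling) =
    (\<integral>\<^sup>+w. H (fst w, coord_perm even_coords (snd w)) *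
      (\<Prod>i<k. cond_prob (odd_then_evens i) (C i) (fst w) (coord_perm even_coords (snd w))) \<partial>sampling)"
  using H
proof (induction k arbitrary: H)
  case (Suc k)
  note [measurable] = Suc.prems C
  have [measurable]: "(\<lambda>w. (reindex A \<sigma> (fst w), coord_perm \<rho> (snd w))) \<in> M \<Otimes>\<^sub>M S \<rightarrow>\<^sub>M M \<Otimes>\<^sub>M S"
    "(\<lambda>w. (reindex A \<sigma> (fst w), snd w)) \<in> M \<Otimes>\<^sub>M S \<rightarrow>\<^sub>M M \<Otimes>\<^sub>M S" for \<sigma> \<rho>
    by (rule measurable_reindex_pair) measurable
  \<comment> \<open>The layout is coordinate \<open>2 * k + 1\<close>, then the k earlier odd
    coordinates, then all even ones. The evens are thus shifted by k, whence the choice of \<iota>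
    below.\<close>
  define \<theta> where "\<theta> n = (case n of 0 \<Rightarrow> 2 * k + 1 | Suc m \<Rightarrow> if m < k then 2 * m + 1 else 2 * (m - k))" for n
  have \<theta>_simps: "\<theta> 0 = 2 * k + 1" "\<And>m. \<theta> (Suc m) = (if m < k then 2 * m + 1 else 2 * (m - k))"
    by (simp_all add: \<theta>_def)
  have \<theta>: "inj \<theta>"
    by (rule injI) (auto simp: \<theta>_def split: nat.splits if_splits; presburger)
  let ?y = "\<lambda>w. coord_perm even_coords (snd w)" and ?z = "\<lambda>w. coord_perm (\<theta> \<circ> Suc) (snd w)"
  let ?I = "\<lambda>k w. \<Prod>i<k. indicator (C i) (snd w (2 * i + 1)) :: ennreal"
  let ?c = "\<lambda>i w. cond_prob (odd_then_evens i) (C i) (fst w) (coord_perm even_coords (snd w))"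
  have y: "?y w = coord_perm (\<lambda>n. k + n) (?z w)" for w :: "(nat \<Rightarrow> 'a) measure \<times> (nat \<Rightarrow> 'a)"
    unfolding coord_perm_coord_perm by (simp add: comp_def \<theta>_simps)
  have I: "?I k w = (\<Prod>i<k. indicator (C i) (?z w i))" for w :: "(nat \<Rightarrow> 'a) measure \<times> (nat \<Rightarrow> 'a)"
    by (rule prod.cong) (simp_all add: coord_perm_def \<theta>_simps)
  have ae: "AE w in sampling. ?c k w = cond_prob \<theta> (C k) (fst w) (?z w)"
    using AE_cond_prob_eq[OF \<theta> inj_odd_then_evens[of k], where \<iota> = "\<lambda>n. k + n", OF _ _ C]
    by (simp add: \<theta>_simps odd_then_evens_Suc)
  have "(\<integral>\<^sup>+w. H (fst w, ?y w) * ?I (Suc k) w \<partial>sampling) =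
      (\<integral>\<^sup>+w. (H (fst w, ?y w) * ?I k w) * indicator (C k) (snd w (\<theta> 0)) \<partial>sampling)"
    by (simp add: \<theta>_simps mult.assoc)
  also have "\<dots> = (\<integral>\<^sup>+w. (H (fst w, ?y w) * ?I k w) * cond_prob \<theta> (C k) (fst w) (?z w) \<partial>sampling)"
  proof -
    have "(\<lambda>w. H (fst w, coord_perm (\<lambda>n. k + n) (snd w)) * (\<Prod>i<k. indicator (C i) (snd w i)))
        \<in> borel_measurable (M \<Otimes>\<^sub>M S)" by measurable
    from nn_integral_cond_prob[OF \<theta> this C] show ?thesis unfolding y I by simp
  qed
  also have "\<dots> = (\<integral>\<^sup>+w. (H (fst w, ?y w) * ?c k w) * ?I k w \<partial>sampling)"
    by (rule nn_integral_cong_AE) (use ae in \<open>eventually_elim, simp add: mult_ac\<close>)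
  also have "\<dots> = (\<integral>\<^sup>+w. (H (fst w, ?y w) * ?c k w) * (\<Prod>i<k. ?c i w) \<partial>sampling)"
  proof -
    have "(\<lambda>w. H w * cond_prob (odd_then_evens k) (C k) (fst w) (snd w)) \<in> borel_measurable (M \<Otimes>\<^sub>M S)"
      by measurable
    from Suc.IH[OF this] show ?thesis by simp
  qed
  also have "\<dots> = (\<integral>\<^sup>+w. H (fst w, ?y w) * (\<Prod>i<Suc k. ?c i w) \<partial>sampling)"
    by (simp add: mult_ac)
  finally show ?case .
qed simp

end

section \<open>The mixture representation\<close>

text \<open>
  The push-forward of \<open>N\<close> under \<open>F\<close> on the largest sigma-algebra that makes \<open>F\<close> measurable, so
  that a map out of it is measurable as soon as its composition with \<open>F\<close> is.
\<close>

definition final_distr :: "'b measure \<Rightarrow> 'c set \<Rightarrow> ('b \<Rightarrow> 'c) \<Rightarrow> 'c measure" where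
  "final_distr N Z F = distr N (sigma Z {X \<in> Pow Z. F -` X \<inter> space N \<in> sets N}) F"

lemma measurable_into_final:
  "F \<in> space N \<rightarrow> Z \<Longrightarrow> F \<in> N \<rightarrow>\<^sub>M sigma Z {X \<in> Pow Z. F -` X \<inter> space N \<in> sets N}"
  by (rule measurable_measure_of) auto

lemma prob_space_final_distr:
  "prob_space N \<Longrightarrow> F \<in> space N \<rightarrow> Z \<Longrightarrow> prob_space (final_distr N Z F)"
  unfolding final_distr_def by (intro prob_space.prob_space_distr measurable_into_final)

lemma measurable_final_distr:
  assumes F: "F \<in> space N \<rightarrow> Z" and g: "g \<in> Z \<rightarrow> space L" and gF: "(\<lambda>x. g (F x)) \<in> N \<rightarrow>\<^sub>M L"
  shows "g \<in> final_distr N Z F \<rightarrow>\<^sub>M L"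
proof (rule measurableI)
  have sp: "space (final_distr N Z F) = Z" unfolding final_distr_def by (simp add: space_measure_of_conv)
  show "g x \<in> space L" if "x \<in> space (final_distr N Z F)" for x using that g sp by auto
  fix V assume V: "V \<in> sets L"
  have "F -` (g -` V \<inter> Z) \<inter> space N = (\<lambda>x. g (F x)) -` V \<inter> space N" using F by auto
  also have "\<dots> \<in> sets N" using gF V by (rule measurable_sets)
  finally have "g -` V \<inter> Z \<in> {X \<in> Pow Z. F -` X \<inter> space N \<in> sets N}" by simp
  then show "g -` V \<inter> space (final_distr N Z F) \<in> sets (final_distr N Z F)"
    unfolding sp unfolding final_distr_def sets_distr by (subst sets_measure_of) (auto intro: sigma_sets.Basic)
qed

lemma distr_final_distr:
  assumes F: "F \<in> space N \<rightarrow> Z" and g: "g \<in> Z \<rightarrow> space L" and gF: "(\<lambda>x. g (F x)) \<in> N \<rightarrow>\<^sub>M L"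
  shows "distr (final_distr N Z F) L g = distr N L (\<lambda>x. g (F x))"
proof -
  have "g \<in> sigma Z {X \<in> Pow Z. F -` X \<inter> space N \<in> sets N} \<rightarrow>\<^sub>M L"
    using measurable_final_distr[OF assms] by (simp add: final_distr_def)
  then show ?thesis
    unfolding final_distr_def by (subst distr_distr[OF _ measurable_into_final[OF F]]) (simp_all add: comp_def)
qed

section \<open>The components and their mixture\<close>

locale exchangeable_law_mixture = exchangeable_law_kernel +
  fixes h
  assumes measurable_h[measurable]: "h \<in> M \<Otimes>\<^sub>M unit_leb \<rightarrow>\<^sub>M S"
    and distr_h: "\<And>\<nu>. \<nu> \<in> space M \<Longrightarrow> distr unit_leb S (\<lambda>t. h (\<nu>, t)) = \<nu>"
begin

interpretation unit_leb: prob_space unit_leb by (rule prob_space_unit_leb)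

lemma measurable_Q_eq: "Q \<rightarrow>\<^sub>M N = M \<rightarrow>\<^sub>M N"
  by (rule measurable_cong_sets[OF sets_Q refl])

text \<open>This is \<lambda>_i as a function of \<mu>. The index i enters only through the
  rearrangement of \<mu>, and the simulated reservoir uses only the even marginal; both facts serve
  \<open>component_class_reindex\<close>.\<close>

definition component :: "nat \<Rightarrow> (nat \<Rightarrow> 'a) measure \<Rightarrow> real \<Rightarrow> 'a measure" where
  "component i \<mu> t = K (reindex A (odd_then_evens i) \<mu>, h (reindex A even_coords \<mu>, t))"

lemma measurable_component_pair[measurable]:
  "(\<lambda>(\<mu>, t). component i \<mu> t) \<in> M \<Otimes>\<^sub>M unit_leb \<rightarrow>\<^sub>M prob_algebra A"
  unfolding component_def by measurable

lemma measurable_component_at: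
  assumes "\<mu> \<in> space M"
  shows "component i \<mu> \<in> unit_leb \<rightarrow>\<^sub>M prob_algebra A"
  using measurable_Pair2[OF measurable_component_pair assms] by simp

lemma measurable_emeasure_component[measurable (raw)]:
  assumes "C \<in> sets A"
  shows "(\<lambda>(\<mu>, t). emeasure (component i \<mu> t) C) \<in> borel_measurable (M \<Otimes>\<^sub>M unit_leb)"
  using measurable_compose[OF measurable_prob_algebraD[OF measurable_component_pair[of i]]
      measurable_emeasure_subprob_algebra[OF assms]]
  by (simp add: case_prod_unfold)

lemma measurable_measure_component[measurable (raw)]:
  assumes "C \<in> sets A"
  shows "(\<lambda>(\<mu>, t). measure (component i \<mu> t) C) \<in> borel_measurable (M \<Otimes>\<^sub>M unit_leb)"
  using measurable_compose[OF measurable_prob_algebraD[OF measurable_component_pair[of i]]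
      measurable_measure_subprob_algebra[OF assms]]
  by (simp add: case_prod_unfold)

definition component_class :: "nat \<Rightarrow> (nat \<Rightarrow> 'a) measure \<Rightarrow> (real \<Rightarrow> 'a measure) set" where
  "component_class i \<mu> = ae_rel A `` {component i \<mu>}"

lemma component_class:
  assumes "\<mu> \<in> space M"
  shows "component_class i \<mu> \<in> ae_classes A" "component i \<mu> \<in> component_class i \<mu>"
proof -
  note m = measurable_component_at[OF assms, of i]
  show "component_class i \<mu> \<in> ae_classes A"
    unfolding component_class_def ae_classes_def using m by (rule quotientI)
  show "component i \<mu> \<in> component_class i \<mu>"
    using m by (simp add: component_class_def ae_rel_def)
qed

definition mixture :: "(nat \<Rightarrow> 'a) measure \<Rightarrow> (nat \<Rightarrow> 'a) measure" where
  "mixture \<mu> = product_mixture (\<lambda>i. component_class i \<mu>)"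

lemma mixture_in: "\<mu> \<in> space M \<Longrightarrow> mixture \<mu> \<in> space M"
  unfolding mixture_def by (rule product_mixture_in) (rule component_class)

lemma emeasure_mixture:
  assumes \<mu>: "\<mu> \<in> space M" and E: "\<And>i. E i \<in> sets A"
  shows "emeasure (mixture \<mu>) {x \<in> space S. \<forall>i<k. x i \<in> E i} =
    (\<integral>\<^sup>+t. (\<Prod>i<k. emeasure (component i \<mu> t) (E i)) \<partial>unit_leb)"
proof -
  have "{x \<in> space S. \<forall>i<k. x i \<in> E i} \<in> sets S" using E by measurable
  then have "emeasure (mixture \<mu>) {x \<in> space S. \<forall>i<k. x i \<in> E i} =
      (\<integral>\<^sup>+t. emeasure (PiM UNIV (\<lambda>i. component i \<mu> t)) {x \<in> space S. \<forall>i<k. x i \<in> E i} \<partial>unit_leb)"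
    unfolding mixture_def by (rule product_mixture_eq[OF component_class(1)[OF \<mu>] component_class(2)[OF \<mu>]])
  also have "\<dots> = (\<integral>\<^sup>+t. (\<Prod>i<k. emeasure (component i \<mu> t) (E i)) \<partial>unit_leb)"
  proof (rule nn_integral_cong)
    fix t assume t: "t \<in> space unit_leb"
    have *: "prob_space (component i \<mu> t)" "sets (component i \<mu> t) = sets A" for i
      using measurable_space[OF measurable_component_at[OF \<mu>] t] by (auto simp: space_prob_algebra)
    interpret product_prob_space "\<lambda>i. component i \<mu> t" "UNIV :: nat set"
      by (rule product_prob_spaceI) (rule *)
    have "space (PiM UNIV (\<lambda>i::nat. component i \<mu> t)) = space S"
      using sets_eq_imp_space_eq[OF *(2)] by (simp add: space_PiM)
    then show "emeasure (PiM UNIV (\<lambda>i. component i \<mu> t)) {x \<in> space S. \<forall>i<k. x i \<in> E i} =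
        (\<Prod>i<k. emeasure (component i \<mu> t) (E i))"
      using emeasure_PiM_Collect[of "{..<k}" E] E by (simp add: * Ball_def)
  qed
  finally show ?thesis .
qed

lemma measurable_mixture: "mixture \<in> M \<rightarrow>\<^sub>M M"
proof (rule measurable_prob_algebra_generated[OF sets_PiM Int_stable_prod_algebra prod_algebra_sets_into_space])
  fix D assume "D \<in> prod_algebra (UNIV :: nat set) (\<lambda>_. A)"
  then obtain k E where E[measurable]: "\<And>i. E i \<in> sets A" and D: "D = {x \<in> space S. \<forall>i<k. x i \<in> E i}"
    by (rule cylinderE) blast
  have "(\<lambda>\<mu>. \<integral>\<^sup>+t. (\<Prod>i<k. emeasure (component i \<mu> t) (E i)) \<partial>unit_leb) \<in> borel_measurable M"
  proof (rule unit_leb.borel_measurable_nn_integral)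
    have "(\<lambda>w. \<Prod>i<k. emeasure (component i (fst w) (snd w)) (E i)) \<in> borel_measurable (M \<Otimes>\<^sub>M unit_leb)"
      using measurable_emeasure_component[OF E] by (intro borel_measurable_prod_ennreal) (simp add: case_prod_unfold)
    then show "(\<lambda>(\<mu>, t). \<Prod>i<k. emeasure (component i \<mu> t) (E i)) \<in> borel_measurable (M \<Otimes>\<^sub>M unit_leb)"
      by (simp add: case_prod_unfold)
  qed
  then show "(\<lambda>\<mu>. emeasure (mixture \<mu>) D) \<in> borel_measurable M"
    unfolding D by (simp add: emeasure_mixture E cong: measurable_cong)
qed (use space_M_D[OF mixture_in] in auto)

text \<open>By \<open>distr_h\<close> the integral over t becomes one over the even coordinates of a
  sample from \<mu>. Conditional independence, with the indicator of an event B of \<mu> as H, then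
  converts the product of conditional probabilities into the event for the odd coordinates.\<close>

lemma AE_mixture_cylinder:
  assumes E[measurable]: "\<And>i. E i \<in> sets A"
  shows "AE \<mu> in Q. emeasure (mixture \<mu>) {x \<in> space S. \<forall>i<k. x i \<in> E i} =
    emeasure (reindex A odd_coords \<mu>) {x \<in> space S. \<forall>i<k. x i \<in> E i}"
proof (rule AE_eq_if_set_nn_integral_eq)
  let ?D = "{x \<in> space S. \<forall>i<k. x i \<in> E i}"
  have D[measurable]: "?D \<in> sets S" by measurable
  have em: "(\<lambda>\<mu>. emeasure (f \<mu>) ?D) \<in> borel_measurable Q" if "f \<in> M \<rightarrow>\<^sub>M M" for f
    unfolding measurable_Q_eq
    by (rule measurable_compose[OF measurable_prob_algebraD[OF that] measurable_emeasure_subprob_algebra[OF D]])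
  show "(\<lambda>\<mu>. emeasure (mixture \<mu>) ?D) \<in> borel_measurable Q" by (rule em[OF measurable_mixture])
  show "(\<lambda>\<mu>. emeasure (reindex A odd_coords \<mu>) ?D) \<in> borel_measurable Q" by (rule em[OF measurable_reindex])
  have "(\<integral>\<^sup>+\<mu>. emeasure (mixture \<mu>) ?D \<partial>Q) \<le> (\<integral>\<^sup>+\<mu>. 1 \<partial>Q)"
    by (rule nn_integral_mono) (simp add: prob_space.emeasure_le_1 space_M_D(3)[OF mixture_in] space_Q)
  also have "\<dots> < \<infinity>" by (simp add: Q.emeasure_space_1)
  finally show "(\<integral>\<^sup>+\<mu>. emeasure (mixture \<mu>) ?D \<partial>Q) < \<infinity>" .
  fix B assume "B \<in> sets Q"
  then have B[measurable]: "B \<in> sets M" by (simp add: sets_Q)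
  have [measurable]: "(\<lambda>w. (reindex A \<sigma> (fst w), snd w)) \<in> M \<Otimes>\<^sub>M S \<rightarrow>\<^sub>M M \<Otimes>\<^sub>M S"
    "(\<lambda>w. (reindex A \<sigma> (fst w), coord_perm \<rho> (snd w))) \<in> M \<Otimes>\<^sub>M S \<rightarrow>\<^sub>M M \<Otimes>\<^sub>M S" for \<sigma> \<rho>
    by measurable
  let ?c = "\<lambda>\<mu> y. \<Prod>i<k. cond_prob (odd_then_evens i) (E i) \<mu> y"
  have mix: "emeasure (mixture \<mu>) ?D = (\<integral>\<^sup>+x. ?c \<mu> (coord_perm even_coords x) \<partial>\<mu>)"
    if \<mu>: "\<mu> \<in> space M" for \<mu>
  proof -
    have \<mu>': "reindex A \<sigma> \<mu> \<in> space M" for \<sigma> using measurable_reindex \<mu> by (rule measurable_space)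
    have [measurable]: "(\<lambda>y. (reindex A \<sigma> \<mu>, y)) \<in> S \<rightarrow>\<^sub>M M \<Otimes>\<^sub>M S" for \<sigma> using \<mu>' by measurable
    have c: "?c \<mu> \<in> borel_measurable S" by measurable
    have h: "(\<lambda>t. h (reindex A even_coords \<mu>, t)) \<in> unit_leb \<rightarrow>\<^sub>M S"
      using measurable_Pair2[OF measurable_h \<mu>'] .
    have "emeasure (mixture \<mu>) ?D = (\<integral>\<^sup>+t. ?c \<mu> (h (reindex A even_coords \<mu>, t)) \<partial>unit_leb)"
      unfolding emeasure_mixture[OF \<mu> E] component_def ..
    also have "\<dots> = (\<integral>\<^sup>+y. ?c \<mu> y \<partial>distr unit_leb S (\<lambda>t. h (reindex A even_coords \<mu>, t)))"
      by (rule nn_integral_distr[OF h, symmetric]) (use c in simp)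
    also have "\<dots> = (\<integral>\<^sup>+x. ?c \<mu> (coord_perm even_coords x) \<partial>\<mu>)"
      unfolding distr_h[OF \<mu>'] by (rule nn_integral_reindex[OF \<mu> c])
    finally show ?thesis .
  qed
  have odd: "emeasure (reindex A odd_coords \<mu>) ?D = (\<integral>\<^sup>+x. (\<Prod>i<k. indicator (E i) (x (2 * i + 1))) \<partial>\<mu>)"
    if \<mu>: "\<mu> \<in> space M" for \<mu>
  proof -
    have "emeasure (reindex A odd_coords \<mu>) ?D = (\<integral>\<^sup>+x. indicator ?D x \<partial>reindex A odd_coords \<mu>)"
      using D by (intro nn_integral_indicator[symmetric]) (simp add: reindex_def)
    also have "\<dots> = (\<integral>\<^sup>+x. indicator ?D (coord_perm odd_coords x) \<partial>\<mu>)"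
      by (rule nn_integral_reindex[OF \<mu>]) measurable
    also have "\<dots> = (\<integral>\<^sup>+x. (\<Prod>i<k. indicator (E i) (x (2 * i + 1))) \<partial>\<mu>)"
    proof (rule nn_integral_cong)
      fix x assume "x \<in> space \<mu>"
      then have "coord_perm odd_coords x \<in> space S"
        using measurable_space[OF measurable_coord_perm] by (simp add: space_M_D(2)[OF \<mu>])
      then have "indicator ?D (coord_perm odd_coords x) = (of_bool (\<forall>i<k. x (2 * i + 1) \<in> E i) :: ennreal)"
        by (auto simp: coord_perm_def indicator_def)
      also have "\<dots> = (\<Prod>i<k. indicator (E i) (x (2 * i + 1)))"
        by (induction k) (auto simp: less_Suc_eq indicator_def)
      finally show "indicator ?D (coord_perm odd_coords x) = (\<Prod>i<k. indicator (E i) (x (2 * i + 1)) :: ennreal)" .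
    qed
    finally show ?thesis .
  qed
  have "(\<integral>\<^sup>+\<mu>\<in>B. emeasure (mixture \<mu>) ?D \<partial>Q) = (\<integral>\<^sup>+\<mu>. (\<integral>\<^sup>+x. ?c \<mu> (coord_perm even_coords x) \<partial>\<mu>) * indicator B \<mu> \<partial>Q)"
    by (rule nn_integral_cong) (simp add: mix space_Q)
  also have "\<dots> = (\<integral>\<^sup>+w. indicator B (fst w) * ?c (fst w) (coord_perm even_coords (snd w)) \<partial>sampling)"
    by (rule set_nn_integral_Q[OF B]) measurable
  also have "\<dots> = (\<integral>\<^sup>+w. indicator B (fst w) * (\<Prod>i<k. indicator (E i) (snd w (2 * i + 1))) \<partial>sampling)"
  proof -
    have "(\<lambda>w. indicator B (fst w) :: ennreal) \<in> borel_measurable (M \<Otimes>\<^sub>M S)" by measurable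
    from conditional_independence[OF this E] show ?thesis by simp
  qed
  also have "\<dots> = (\<integral>\<^sup>+\<mu>. (\<integral>\<^sup>+x. (\<Prod>i<k. indicator (E i) (x (2 * i + 1))) \<partial>\<mu>) * indicator B \<mu> \<partial>Q)"
    by (rule set_nn_integral_Q[OF B, symmetric]) measurable
  also have "\<dots> = (\<integral>\<^sup>+\<mu>\<in>B. emeasure (reindex A odd_coords \<mu>) ?D \<partial>Q)"
    by (rule nn_integral_cong) (simp only: odd space_Q)
  finally show "(\<integral>\<^sup>+\<mu>\<in>B. emeasure (mixture \<mu>) ?D \<partial>Q) = (\<integral>\<^sup>+\<mu>\<in>B. emeasure (reindex A odd_coords \<mu>) ?D \<partial>Q)" .
qed

text \<open>On cylinders the mixture is almost surely the odd marginal of \<mu>, and that marginal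
  has law Q because \<open>odd_coords\<close> is injective.\<close>

lemma distr_mixture: "distr Q M mixture = Q"
proof -
  have mQ: "f \<in> Q \<rightarrow>\<^sub>M M" if "f \<in> M \<rightarrow>\<^sub>M M" for f using that by (simp only: measurable_Q_eq)
  have "distr Q M mixture = distr Q M (\<lambda>\<mu>. \<mu>)"
  proof (rule random_measure_law_eqI[OF mQ[OF measurable_mixture] _ prob_Q sets_PiM Int_stable_prod_algebra prod_algebra_sets_into_space])
    show "(\<lambda>\<mu>. \<mu>) \<in> Q \<rightarrow>\<^sub>M M" by (rule mQ) simp
    fix F assume F: "finite F" "F \<subseteq> prod_algebra (UNIV :: nat set) (\<lambda>_. A)"
    have "AE \<mu> in Q. emeasure (mixture \<mu>) D = emeasure (reindex A odd_coords \<mu>) D" if "D \<in> F" for D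
    proof -
      from that F(2) have "D \<in> prod_algebra (UNIV :: nat set) (\<lambda>_. A)" by blast
      then obtain k E where E: "\<And>i. E i \<in> sets A" and D: "D = {x \<in> space S. \<forall>i<k. x i \<in> E i}"
        by (rule cylinderE) blast
      show ?thesis unfolding D by (rule AE_mixture_cylinder[OF E])
    qed
    moreover have "inj odd_coords" by (rule injI) simp
    ultimately show "\<exists>X'\<in>Q \<rightarrow>\<^sub>M M. distr Q M X' = distr Q M (\<lambda>\<mu>. \<mu>) \<and>
        (\<forall>D\<in>F. AE w in Q. emeasure (mixture w) D = emeasure (X' w) D)"
      using mQ[OF measurable_reindex, of odd_coords] distr_reindex_inj[of odd_coords] distr_id2[OF sets_Q[symmetric]]
      by (intro bexI[of _ "reindex A odd_coords"]) simp_all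
  qed
  then show ?thesis using distr_id2[OF sets_Q[symmetric]] by simp
qed

text \<open>On these classes a pairing is an integral over t of a function jointly measurable in
  \<mu> and t, so measurability in \<mu> is the measurability part of Fubini's theorem.\<close>

lemma measurable_component_class: "component_class i \<in> M \<rightarrow>\<^sub>M B_space A"
  unfolding B_space_def
proof (rule measurable_measure_of)
  show "component_class i \<in> space M \<rightarrow> ae_classes A" by (intro funcsetI component_class(1))
  fix y assume "y \<in> {pairing \<phi> C -` U \<inter> ae_classes A |\<phi> C U. \<phi> \<in> Linfty_unit \<and> C \<in> sets A \<and> U \<in> sets borel}"
  then obtain \<phi> C U where y: "y = pairing \<phi> C -` U \<inter> ae_classes A"
    and \<phi>: "\<phi> \<in> Linfty_unit" and C: "C \<in> sets A" and U: "U \<in> sets borel" by blast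
  have [measurable]: "\<phi> \<in> borel_measurable unit_leb" using \<phi> by (simp add: Linfty_unit_def)
  have "(\<lambda>\<mu>. \<integral>t. \<phi> t * measure (component i \<mu> t) C \<partial>unit_leb) \<in> borel_measurable M"
  proof (rule unit_leb.borel_measurable_lebesgue_integral)
    have "(\<lambda>w. measure (component i (fst w) (snd w)) C) \<in> borel_measurable (M \<Otimes>\<^sub>M unit_leb)"
      using measurable_measure_component[OF C, of i] by (simp add: case_prod_unfold)
    then have "(\<lambda>w. \<phi> (snd w) * measure (component i (fst w) (snd w)) C) \<in> borel_measurable (M \<Otimes>\<^sub>M unit_leb)"
      by measurable
    then show "(\<lambda>(\<mu>, t). \<phi> t * measure (component i \<mu> t) C) \<in> borel_measurable (M \<Otimes>\<^sub>M unit_leb)"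
      by (simp add: case_prod_unfold)
  qed
  then have "(\<lambda>\<mu>. pairing \<phi> C (component_class i \<mu>)) \<in> borel_measurable M"
    by (simp add: pairing_eq[OF component_class C \<phi>] cong: measurable_cong)
  then have "(\<lambda>\<mu>. pairing \<phi> C (component_class i \<mu>)) -` U \<inter> space M \<in> sets M" using U by (rule measurable_sets)
  also have "(\<lambda>\<mu>. pairing \<phi> C (component_class i \<mu>)) -` U \<inter> space M = component_class i -` y \<inter> space M"
    using component_class(1) by (auto simp: y)
  finally show "component_class i -` y \<inter> space M \<in> sets M" .
qed auto

section \<open>Exchangeability of the components\<close>

definition odd_perm :: "(nat \<Rightarrow> nat) \<Rightarrow> nat \<Rightarrow> nat" where
  "odd_perm \<sigma> n = (if odd n then 2 * \<sigma> (n div 2) + 1 else n)"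

lemma inj_odd_perm: "inj \<sigma> \<Longrightarrow> inj (odd_perm \<sigma>)"
  by (rule injI) (auto simp: odd_perm_def inj_eq split: if_splits elim!: oddE; presburger)

text \<open>The equality holds for every \<mu>: \<open>odd_perm \<sigma>\<close> fixes the reservoir
  and carries \<open>odd_then_evens i\<close> to \<open>odd_then_evens (\<sigma> i)\<close>, so even
  the chosen functions \<open>component\<close> coincide.\<close>

lemma component_class_reindex:
  assumes "\<mu> \<in> space M"
  shows "component_class i (reindex A (odd_perm \<sigma>) \<mu>) = component_class (\<sigma> i) \<mu>"
proof -
  have "odd_perm \<sigma> \<circ> odd_then_evens i = odd_then_evens (\<sigma> i)"
    by (rule ext) (simp add: odd_perm_def odd_then_evens_def split: nat.split)
  moreover have "odd_perm \<sigma> \<circ> even_coords = even_coords" by (rule ext) (simp add: odd_perm_def)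
  ultimately have "component i (reindex A (odd_perm \<sigma>) \<mu>) = component (\<sigma> i) \<mu>"
    by (intro ext) (simp add: component_def reindex_reindex[OF assms])
  then show ?thesis by (simp add: component_class_def)
qed

text \<open>The new sample space is to consist of sequences of classes, so Q is carried over to
  them. With the final sigma-algebra, measurability of \<open>product_mixture\<close> reduces to
  that of \<open>mixture\<close>.\<close>

definition class_sequence_space :: "(nat \<Rightarrow> (real \<Rightarrow> 'a measure) set) measure" where
  "class_sequence_space = final_distr Q (UNIV \<rightarrow> ae_classes A) (\<lambda>\<mu> i. component_class i \<mu>)"

lemma class_sequence_in: "(\<lambda>\<mu> i. component_class i \<mu>) \<in> space Q \<rightarrow> UNIV \<rightarrow> ae_classes A"
  using component_class(1) by (auto simp: space_Q)

lemma prob_space_class_sequence: "prob_space class_sequence_space"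
  unfolding class_sequence_space_def by (rule prob_space_final_distr[OF prob_Q class_sequence_in])

lemma space_B_space: "space (B_space A) = ae_classes A"
  unfolding B_space_def by (simp add: space_measure_of_conv)

lemma measurable_class_sequence:
  "(\<lambda>\<mu> i. component_class (\<sigma> i) \<mu>) \<in> M \<rightarrow>\<^sub>M seq_space (B_space A)"
  using component_class(1)
  by (intro measurable_PiM_single' measurable_component_class) (auto simp: space_B_space)

lemma exchangeable_class_sequence:
  "exchangeable_sequence class_sequence_space (B_space A) (\<lambda>i \<omega>. \<omega> i)"
  unfolding exchangeable_sequence_def same_law_def
proof (intro conjI allI ballI)
  have Zs: "(\<lambda>\<omega> i. \<omega> (\<sigma> i)) \<in> (UNIV \<rightarrow> ae_classes A) \<rightarrow> space (seq_space (B_space A))" for \<sigma> :: "nat \<Rightarrow> nat"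
    by (auto simp: space_PiM space_B_space)
  have mQ': "(\<lambda>\<mu> i. component_class (\<sigma> i) \<mu>) \<in> Q \<rightarrow>\<^sub>M seq_space (B_space A)" for \<sigma>
    unfolding measurable_Q_eq by (rule measurable_class_sequence)
  have m: "(\<lambda>\<omega> i. \<omega> (\<sigma> i)) \<in> class_sequence_space \<rightarrow>\<^sub>M seq_space (B_space A)" for \<sigma> :: "nat \<Rightarrow> nat"
    unfolding class_sequence_space_def by (rule measurable_final_distr[OF class_sequence_in Zs]) (rule mQ')
  have d: "distr class_sequence_space (seq_space (B_space A)) (\<lambda>\<omega> i. \<omega> (\<sigma> i)) =
      distr Q (seq_space (B_space A)) (\<lambda>\<mu> i. component_class (\<sigma> i) \<mu>)" for \<sigma> :: "nat \<Rightarrow> nat"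
    unfolding class_sequence_space_def by (rule distr_final_distr[OF class_sequence_in Zs]) (rule mQ')
  show "(\<lambda>\<omega>. \<omega> i) \<in> class_sequence_space \<rightarrow>\<^sub>M B_space A" for i
    using measurable_compose[OF m[of id] measurable_component_singleton[of i]] by simp
  show "(\<lambda>\<omega> i. \<omega> i) \<in> class_sequence_space \<rightarrow>\<^sub>M seq_space (B_space A)" using m[of id] by simp
  fix \<sigma> assume \<sigma>: "\<sigma> \<in> finitary_perms"
  then have "inj \<sigma>" by (auto simp: finitary_perms_def bij_is_inj)
  show "(\<lambda>\<omega> i. \<omega> (\<sigma> i)) \<in> class_sequence_space \<rightarrow>\<^sub>M seq_space (B_space A)" by (rule m)
  have "distr class_sequence_space (seq_space (B_space A)) (\<lambda>\<omega> i. \<omega> (\<sigma> i)) =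
      distr Q (seq_space (B_space A)) (\<lambda>\<mu> i. component_class (\<sigma> i) \<mu>)" by (rule d)
  also have "\<dots> = distr Q (seq_space (B_space A)) (\<lambda>\<mu> i. component_class i (reindex A (odd_perm \<sigma>) \<mu>))"
    by (rule distr_cong) (simp_all add: component_class_reindex space_Q)
  also have "\<dots> = distr (distr Q M (reindex A (odd_perm \<sigma>))) (seq_space (B_space A)) (\<lambda>\<mu> i. component_class i \<mu>)"
  proof -
    have "reindex A (odd_perm \<sigma>) \<in> Q \<rightarrow>\<^sub>M M" by measurable
    from distr_distr[OF measurable_class_sequence[of id] this] show ?thesis by (simp add: comp_def)
  qed
  also have "\<dots> = distr Q (seq_space (B_space A)) (\<lambda>\<mu> i. component_class i \<mu>)"
    unfolding distr_reindex_inj[OF inj_odd_perm[OF \<open>inj \<sigma>\<close>]] ..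
  also have "\<dots> = distr class_sequence_space (seq_space (B_space A)) (\<lambda>\<omega> i. \<omega> i)"
    using d[of id] by simp
  finally show "distr class_sequence_space (seq_space (B_space A)) (\<lambda>\<omega> i. \<omega> (\<sigma> i)) =
      distr class_sequence_space (seq_space (B_space A)) (\<lambda>\<omega> i. \<omega> i)" .
qed

lemma law_class_sequence_mixture:
  "product_mixture \<in> class_sequence_space \<rightarrow>\<^sub>M M"
  "distr class_sequence_space M product_mixture = Q"
proof -
  have Z: "product_mixture \<in> (UNIV \<rightarrow> ae_classes A) \<rightarrow> space M"
    by (auto intro: product_mixture_in)
  have m: "(\<lambda>\<mu>. product_mixture (\<lambda>i. component_class i \<mu>)) \<in> Q \<rightarrow>\<^sub>M M"
    unfolding measurable_Q_eq using measurable_mixture by (simp only: mixture_def[abs_def])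
  show "product_mixture \<in> class_sequence_space \<rightarrow>\<^sub>M M"
    unfolding class_sequence_space_def by (rule measurable_final_distr[OF class_sequence_in Z]) (rule m)
  show "distr class_sequence_space M product_mixture = Q"
    unfolding class_sequence_space_def
    by (subst distr_final_distr[OF class_sequence_in Z]) (use m distr_mixture in \<open>simp_all add: mixture_def[abs_def]\<close>)
qed

end

theorem theoremB:
  fixes A :: "'a measure"
    and \<Omega> :: "'w measure"
    and \<mu> :: "'w \<Rightarrow> (nat \<Rightarrow> 'a) measure"
  assumes "standard_borel A"
    and "prob_space \<Omega>"
    and "exchangeable_random_measure \<Omega> A \<mu>"
  shows "\<exists>(\<Omega>' :: (nat \<Rightarrow> (real \<Rightarrow> 'a measure) set) measure) \<Lambda>.
           prob_space \<Omega>' \<and>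
           exchangeable_sequence \<Omega>' (B_space A) \<Lambda> \<and>
           same_law \<Omega> \<mu> \<Omega>' (\<lambda>\<omega>. product_mixture (\<lambda>i. \<Lambda> i \<omega>)) (prob_algebra (seq_space A))"
proof -
  interpret \<Omega>: prob_space \<Omega> by fact
  let ?M = "prob_algebra (seq_space A)"
  have \<mu>: "\<mu> \<in> \<Omega> \<rightarrow>\<^sub>M ?M" and ex: "\<And>\<sigma>. \<sigma> \<in> finitary_perms \<Longrightarrow>
      distr \<Omega> ?M \<mu> = distr \<Omega> ?M (\<lambda>\<omega>. reindex A \<sigma> (\<mu> \<omega>))"
    using assms(3) by (auto simp: exchangeable_random_measure_def same_law_def reindex_def)
  define Q where "Q = distr \<Omega> ?M \<mu>"
  interpret exchangeable_law A Q
  proof (rule exchangeable_law.intro)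
    show "prob_space Q" unfolding Q_def by (rule \<Omega>.prob_space_distr[OF \<mu>])
    show "sets Q = sets ?M" by (simp add: Q_def)
    fix \<sigma> assume "\<sigma> \<in> finitary_perms"
    then show "distr Q ?M (reindex A \<sigma>) = Q"
      unfolding Q_def using \<mu> by (subst distr_distr) (simp_all add: comp_def ex[symmetric] measurable_reindex)
  qed
  \<comment> \<open>The definition of a standard Borel space admits the empty one; it is excluded
    here because a probability measure on \<open>seq_space A\<close> exists.\<close>
  have "space A \<noteq> {}"
  proof
    assume "space A = {}"
    then have "space (seq_space A) = {}" by (auto simp: space_PiM PiE_eq_empty_iff)
    moreover obtain \<omega> where "\<omega> \<in> space \<Omega>" using \<Omega>.not_empty by blast
    then have "\<mu> \<omega> \<in> space ?M" by (rule measurable_space[OF \<mu>])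
    ultimately show False
      using prob_space.not_empty[OF space_M_D(3)] space_M_D(2) by metis
  qed
  from standard_borel_retract_unit[OF assms(1) this]
  have R: "measurable_retract A (restrict_space borel {0..1::real})"
    "measurable_retract (seq_space A) (restrict_space borel {0..1::real})" .
  obtain K where K: "exchangeable_law_kernel A Q K" by (rule kernel_exists[OF R(1)])
  obtain h where h: "h \<in> ?M \<Otimes>\<^sub>M unit_leb \<rightarrow>\<^sub>M seq_space A"
    "\<And>\<nu>. \<nu> \<in> space ?M \<Longrightarrow> distr unit_leb (seq_space A) (\<lambda>t. h (\<nu>, t)) = \<nu>"
    by (rule measurable_parametrization[OF R(2)]) blast
  interpret exchangeable_law_kernel A Q K by (rule K)
  interpret exchangeable_law_mixture A Q K h
    by (intro exchangeable_law_mixture.intro exchangeable_law_mixture_axioms.intro K h)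
  show ?thesis
    using prob_space_class_sequence exchangeable_class_sequence law_class_sequence_mixture \<mu>
    by (intro exI[of _ class_sequence_space] exI[of _ "\<lambda>i \<omega>. \<omega> i"]) (simp add: same_law_def Q_def)
qed

end
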